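(* Let $N \geq 4$ and $2 \leq d \leq N-2$. The tree in $\mathcal{T}_{N,d}$ with smallest $\mathcal{H}_2$ norm is $P_{N,d,\lfloor\frac{d}{2}\rfloor}$; that is, for every $T \in \mathcal{T}_{N,d}$ one has $\mathcal{H}_2(T) \geq \mathcal{H}_2\left(P_{N,d,\lfloor\frac{d}{2}\rfloor}\right)$, with equality only if $T = P_{N,d,\lfloor\frac{d}{2}\rfloor}$.
   Context: All trees are finite, undirected, with unit weight on every edge; equality of trees means graph isomorphism. The distance between two nodes is the number of edges on the path joining them, and the diameter of a tree is the maximum distance between two of its nodes. $\mathcal{T}_{N,d}$ is the set of all trees with $N$ nodes and diameter $d$. $\mathcal{H}_2$ norm: for a connected undirected graph on $N$ nodes with Laplacian $L = D - A$ ($A$ the adjacency matrix, $D$ the diagonal matrix of degrees), let $0=\lambda_1 < \lambda_2 \leq \dots \leq \lambda_N$ be the eigenvalues of $L$. The $\mathcal{H}_2$ norm of the graph is $\mathcal{H}_2 = \left(\sum_{i=2}^{N}\frac{1}{2\lambda_i}\right)^{1/2}$. (This is the $\mathcal{H}_2$ norm of the system $\dot y = -QLQ^T y + Q\xi$ with output $z=y$, where the rows of $Q\in\mathbb{R}^{(N-1)\times N}$ form an orthonormal basis of the orthogonal complement of the all-ones vector.) The tree $P_{N,d,i}$ (for $2 \leq d \leq N-2$ and $1 \leq i \leq \lfloor\frac{d}{2}\rfloor$): take a path of length $d$ (with $d+1$ nodes), number its internal nodes consecutively $1,\dots,d-1$ along the path, and attach $N-d-1$ additional leaf nodes to the $i$-th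 internal node. *)

theory Defs
  imports
    "Graph_Theory.Graph_Theory"
    "Jordan_Normal_Form.Char_Poly"
begin

text \<open>
  Finite simple undirected graphs are rendered as \<open>pair_graph\<close>: every undirected edge is
  represented by the two arcs \<open>(u, v)\<close> and \<open>(v, u)\<close>.  For this reason the predicate
  \<open>tree\<close> of \<open>Graph_Theory\<close> cannot be used: there the closed walk \<open>u, v, u\<close> counts as a
  cycle, so no \<open>pair_graph\<close> with an edge is a \<open>forest\<close>.  Undirected cycles have length at
  least 3.
\<close>

definition undirected_tree :: "'a pair_pre_digraph \<Rightarrow> bool" where
  "undirected_tree G \<longleftrightarrow>
     pair_graph G \<and> connected (with_proj G) \<and>
     \<not> (\<exists>p. pre_digraph.cycle (with_proj G) p \<and> 3 \<le> length p)"

text \<open>In a tree the path joining two nodes is unique.\<close>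

definition tree_dist :: "'a pair_pre_digraph \<Rightarrow> 'a \<Rightarrow> 'a \<Rightarrow> nat" where
  "tree_dist G u v = length (THE p. pre_digraph.apath (with_proj G) u p v)"

definition tree_diameter :: "'a pair_pre_digraph \<Rightarrow> nat" where
  "tree_diameter G = Max {tree_dist G u v | u v. u \<in> pverts G \<and> v \<in> pverts G}"

definition trees :: "nat \<Rightarrow> nat \<Rightarrow> 'a pair_pre_digraph set" where
  "trees N d = {G. undirected_tree G \<and> card (pverts G) = N \<and> tree_diameter G = d}"

text \<open>
  The matrices are indexed by positions in an enumeration \<open>vs\<close> of the nodes.
\<close>

definition adjacency_mat :: "'a list \<Rightarrow> 'a pair_pre_digraph \<Rightarrow> real mat" where
  "adjacency_mat vs G =
     mat (length vs) (length vs) (\<lambda>(i, j). if (vs ! i, vs ! j) \<in> parcs G then 1 else 0)"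

definition degree_mat :: "'a list \<Rightarrow> 'a pair_pre_digraph \<Rightarrow> real mat" where
  "degree_mat vs G =
     mat (length vs) (length vs)
       (\<lambda>(i, j). if i = j then real (out_degree (with_proj G) (vs ! i)) else 0)"

definition laplacian_mat :: "'a list \<Rightarrow> 'a pair_pre_digraph \<Rightarrow> real mat" where
  "laplacian_mat vs G = degree_mat vs G - adjacency_mat vs G"

lemma laplacian_mat_carrier: "laplacian_mat vs G \<in> carrier_mat (length vs) (length vs)"
  unfolding laplacian_mat_def degree_mat_def adjacency_mat_def by (rule minus_carrier_mat) auto

lemma laplacian_mat_index:
  "i < length vs \<Longrightarrow> j < length vs \<Longrightarrow> laplacian_mat vs G $$ (i, j) =
     (if i = j then real (out_degree (with_proj G) (vs ! i)) else 0) -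
     (if (vs ! i, vs ! j) \<in> parcs G then 1 else 0)"
  unfolding laplacian_mat_def degree_mat_def adjacency_mat_def
  by (subst index_minus_mat) simp_all

lemma char_poly_laplacian_mat_enum:
  assumes vs: "distinct vs" and ws: "distinct ws" and eq: "set vs = set ws"
  shows "char_poly (laplacian_mat vs G) = char_poly (laplacian_mat ws G)"
proof -
  define n where "n = length ws"
  have n: "length vs = n" using distinct_card[OF vs] distinct_card[OF ws] eq by (simp add: n_def)
  define P :: "real mat" where "P = mat n n (\<lambda>(i, j). if vs ! i = ws ! j then 1 else 0)"
  define Q :: "real mat" where "Q = mat n n (\<lambda>(i, j). if ws ! i = vs ! j then 1 else 0)"
  have "\<forall>i\<in>{..<n}. \<exists>k. k < n \<and> ws ! k = vs ! i"
    using eq n nth_mem[of _ vs] by (auto simp: in_set_conv_nth n_def)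
  then obtain f where f: "\<And>i. i < n \<Longrightarrow> f i < n" "\<And>i. i < n \<Longrightarrow> ws ! f i = vs ! i"
    unfolding bchoice_iff by blast
  have "\<forall>i\<in>{..<n}. \<exists>k. k < n \<and> vs ! k = ws ! i"
    using eq[symmetric] n nth_mem[of _ ws] by (auto simp: in_set_conv_nth n_def)
  then obtain g where g: "\<And>i. i < n \<Longrightarrow> g i < n" "\<And>i. i < n \<Longrightarrow> vs ! g i = ws ! i"
    unfolding bchoice_iff by blast
  have vsi: "vs ! i = vs ! j \<longleftrightarrow> i = j" if "i < n" "j < n" for i j
    using that vs n by (simp add: nth_eq_iff_index_eq)
  have wsi: "ws ! i = ws ! j \<longleftrightarrow> i = j" if "i < n" "j < n" for i j
    using that ws n_def by (simp add: nth_eq_iff_index_eq)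
  have Pf: "vs ! i = ws ! j \<longleftrightarrow> j = f i" if "i < n" "j < n" for i j
    using wsi[OF that(2) f(1)[OF that(1)]] f(2)[OF that(1)] by metis
  have Qg: "ws ! i = vs ! j \<longleftrightarrow> j = g i" if "i < n" "j < n" for i j
    using vsi[OF that(2) g(1)[OF that(1)]] g(2)[OF that(1)] by metis
  have fg: "f (g i) = i" "g (f i) = i" if "i < n" for i
    using wsi[OF f(1)[OF g(1)[OF that]] that] f(2)[OF g(1)[OF that]] g(2)[OF that]
      vsi[OF g(1)[OF f(1)[OF that]] that] g(2)[OF f(1)[OF that]] f(2)[OF that] by simp_all
  let ?A = "laplacian_mat vs G" and ?B = "laplacian_mat ws G"
  have A: "?A \<in> carrier_mat n n" and B: "?B \<in> carrier_mat n n"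
    using laplacian_mat_carrier[of vs G] laplacian_mat_carrier[of ws G] n by (simp_all add: n_def)
  have P: "P \<in> carrier_mat n n" and Q: "Q \<in> carrier_mat n n" by (auto simp: P_def Q_def)
  have sd: "(\<Sum>k = 0..<n. (if k = a then 1 else 0) * F k) = (F a :: real)" if "a < n" for a F
  proof -
    have "(\<Sum>k = 0..<n. (if k = a then 1 else 0) * F k) = (\<Sum>k = 0..<n. if k = a then F k else 0)"
      by (intro sum.cong) auto
    then show ?thesis using that by simp
  qed
  have mP: "(P * M) $$ (i, j) = M $$ (f i, j)"
    if "i < n" "j < n" "M \<in> carrier_mat n n" for i j M
  proof -
    have "(P * M) $$ (i, j) = (\<Sum>k = 0..<n. P $$ (i, k) * M $$ (k, j))"
      using that P by (simp add: scalar_prod_def)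
    also have "\<dots> = (\<Sum>k = 0..<n. (if k = f i then 1 else 0) * M $$ (k, j))"
      using that by (intro sum.cong) (auto simp: P_def Pf)
    finally show ?thesis using sd[of "f i" "\<lambda>k. M $$ (k, j)"] f that by simp
  qed
  have mQ: "(Q * M) $$ (i, j) = M $$ (g i, j)"
    if "i < n" "j < n" "M \<in> carrier_mat n n" for i j M
  proof -
    have "(Q * M) $$ (i, j) = (\<Sum>k = 0..<n. Q $$ (i, k) * M $$ (k, j))"
      using that Q by (simp add: scalar_prod_def)
    also have "\<dots> = (\<Sum>k = 0..<n. (if k = g i then 1 else 0) * M $$ (k, j))"
      using that by (intro sum.cong) (auto simp: Q_def Qg)
    finally show ?thesis using sd[of "g i" "\<lambda>k. M $$ (k, j)"] g that by simp
  qed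
  have PQ: "P * Q = 1\<^sub>m n"
  proof (rule eq_matI)
    fix i j assume "i < dim_row (1\<^sub>m n :: real mat)" "j < dim_col (1\<^sub>m n :: real mat)"
    then have ij: "i < n" "j < n" by auto
    have "(P * Q) $$ (i, j) = Q $$ (f i, j)" using mP ij Q by blast
    then show "(P * Q) $$ (i, j) = 1\<^sub>m n $$ (i, j)" using ij f vsi by (simp add: Q_def)
  qed (use P Q in auto)
  have QP: "Q * P = 1\<^sub>m n"
  proof (rule eq_matI)
    fix i j assume "i < dim_row (1\<^sub>m n :: real mat)" "j < dim_col (1\<^sub>m n :: real mat)"
    then have ij: "i < n" "j < n" by auto
    have "(Q * P) $$ (i, j) = P $$ (g i, j)" using mQ ij P by blast
    then show "(Q * P) $$ (i, j) = 1\<^sub>m n $$ (i, j)" using ij g wsi by (simp add: P_def)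
  qed (use P Q in auto)
  have AP: "?A * P = P * ?B"
  proof (rule eq_matI)
    fix i j assume "i < dim_row (P * ?B)" "j < dim_col (P * ?B)"
    then have ij: "i < n" "j < n" using P B by auto
    have l: "(P * ?B) $$ (i, j) = ?B $$ (f i, j)" using mP ij B by blast
    have "(?A * P) $$ (i, j) = (\<Sum>k = 0..<n. ?A $$ (i, k) * P $$ (k, j))"
      using ij A P by (simp add: scalar_prod_def)
    also have "\<dots> = (\<Sum>k = 0..<n. (if k = g j then 1 else 0) * ?A $$ (i, k))"
      using ij Qg by (intro sum.cong) (auto simp: P_def eq_commute[of "vs ! _" "ws ! _"])
    finally have r: "(?A * P) $$ (i, j) = ?A $$ (i, g j)"
      using sd[of "g j" "\<lambda>k. ?A $$ (i, k)"] g ij by simp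
    have "i = g j \<longleftrightarrow> f i = j" using fg ij by metis
    then show "(?A * P) $$ (i, j) = (P * ?B) $$ (i, j)"
      unfolding l r using ij f g n n_def by (auto simp add: laplacian_mat_index)
  qed (use A B P in auto)
  have "?A = P * ?B * Q"
    unfolding AP[symmetric] using assoc_mult_mat[OF A P Q] PQ A by simp
  then have "similar_mat ?A ?B"
    using similar_matI[of ?A ?B P Q n] A B P Q PQ QP by auto
  then show ?thesis by (rule char_poly_similar)
qed

text \<open>
  The eigenvalues of the Laplacian, with multiplicity and in increasing order.  By
  \<open>char_poly_laplacian_mat_enum\<close> the choice of the enumeration is immaterial.  The Laplacian is
  symmetric, so the real roots of its characteristic polynomial are all its eigenvalues.
\<close>

definition laplacian_spectrum :: "'a pair_pre_digraph \<Rightarrow> real list" where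
  "laplacian_spectrum G =
     sorted_list_of_multiset (proots (char_poly
       (laplacian_mat (SOME vs. distinct vs \<and> set vs = pverts G) G)))"

text \<open>
  List positions start at 0, so \<open>laplacian_spectrum G ! i\<close> is $\lambda_{i+1}$ and the sum omits
  exactly $\lambda_1 = 0$.
\<close>

definition h2_norm :: "'a pair_pre_digraph \<Rightarrow> real" where
  "h2_norm G =
     sqrt (\<Sum>i = 1..<card (pverts G). 1 / (2 * laplacian_spectrum G ! i))"

text \<open>
  \<open>P_tree N d i\<close> has the path \<open>0, 1, \<dots>, d\<close>, whose internal nodes \<open>1, \<dots>, d - 1\<close> are thus
  numbered by themselves, and the leaves \<open>d + 1, \<dots>, N - 1\<close> attached to node \<open>i\<close>.
\<close>

definition P_tree :: "nat \<Rightarrow> nat \<Rightarrow> nat \<Rightarrow> nat pair_pre_digraph" where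
  "P_tree N d i =
     (let E = {(k, Suc k) | k. k < d} \<union> {(i, v) | v. d < v \<and> v < N}
      in \<lparr>pverts = {0..<N}, parcs = E \<union> E\<inverse>\<rparr>)"

end

theory Submission
  imports Defs "Jordan_Normal_Form.Schur_Decomposition"
begin

text \<open>
  The sum of the reciprocals of the nonzero Laplacian eigenvalues of a tree on $N$ nodes is $W / N$,
  where $W$ is the Wiener index, the sum of the distances of all unordered pairs of nodes.  So
  minimising the \<open>\<H>\<^sub>2\<close> norm means minimising the Wiener index.

  For the spectral identity, let $D$ be the distance matrix and $J$ the all-ones matrix.  In a tree,
  exactly one neighbour of $u$ is closer to $v \neq u$ and all others are farther away, which gives
  $(LD)_{uv} = 2 - \deg u - 2 \delta_{uv}$.  From this, $L + J/N$ has an explicit inverse built from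
  $D$, with trace $1 + W / N$.  A Schur decomposition of $L$ that lists the eigenvalue 0 first starts
  with a constant vector, so it triangularises $L + J/N$ too, with the diagonal entry 0 replaced
  by 1; the inverse then has the reciprocals on its diagonal (\<open>sum_inverse_eigenvalues\<close>,
  \<open>h2_norm_eq_total_distance\<close>).

  For the extremal problem, fix a path $v_0, \dots, v_d$ realising the diameter and let $R$ be the set
  of the remaining nodes.  A tree distance has no interior peaks along a path, so the distances from
  $x \in R$ to the path are $h + |i - j|$ for some $j$, with $h \ge 1$.  Their sum
  is least for $h = 1$ and $j$ central, and each $x$ not adjacent to the path costs at least
  $d + 1 \ge 3$ more.  Two distinct nodes of $R$ are at distance at least 2 unless adjacent, and then one of them is
  the neighbour of the other towards $v_0$ and that other one is not adjacent to the path.  Thus the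
  number of adjacent pairs in $R$ is at most the number of nodes of $R$ off the path by more than one
  step, and the extra cost of such nodes exceeds the gain (\<open>total_distance_ge\<close>).  In the case of
  equality all distances are those of \<open>P_tree\<close>, and an isometry of trees is an isomorphism.

  All combinatorics is carried out on the distance function alone: the locale \<open>tree_metric\<close> states the
  properties that characterise the distance functions of trees (\<open>tree_metric_tree_dist\<close> and
  \<open>undirected_tree_if_tree_metric\<close>).
\<close>

section \<open>Distances along a path\<close>

text \<open>
  Truncated subtraction makes one summand vanish, so this is $|i - j|$.
\<close>

definition absdiff :: "nat \<Rightarrow> nat \<Rightarrow> nat" where
  "absdiff i j = (i - j) + (j - i)"

text \<open>
  In graph theory, the transmission of a node is the sum of its distances to all nodes; here, for
  the node \<open>j\<close> of the path \<open>0, \<dots>, d\<close>.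
\<close>

definition transmission :: "nat \<Rightarrow> nat \<Rightarrow> nat" where
  "transmission d j = (\<Sum>i\<le>d. absdiff i j)"

text \<open>
  This yields the distances from a node of a tree to the nodes of a path.  Starting from a
  position of the minimum, the first step must go up; afterwards each step has to go up
  because a step down would create a peak.
\<close>

lemma v_shaped_sequence:
  fixes g :: "nat \<Rightarrow> nat"
  assumes step: "\<And>i. i < d \<Longrightarrow> g (Suc i) = g i + 1 \<or> g i = g (Suc i) + 1"
    and no_peak: "\<And>i. Suc i < d \<Longrightarrow> g (Suc i) = g i + 1 \<Longrightarrow> g (Suc i) \<noteq> g (Suc (Suc i)) + 1"
  obtains j where "j \<le> d" "\<And>i. i \<le> d \<Longrightarrow> g i = g j + absdiff i j"
proof -
  obtain j where j: "j \<le> d" and jmin: "\<And>i. i \<le> d \<Longrightarrow> g j \<le> g i"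
    using arg_min_if_finite[of "{..d}" g] by (metis atMost_iff empty_iff finite_atMost not_le le0)
  have up: "g (Suc i) = g i + 1" if "j \<le> i" "i < d" for i
    using that
  proof (induction i rule: dec_induct)
    case base
    then show ?case using step[of j] jmin[of "Suc j"] by auto
  next
    case (step i)
    then show ?case using no_peak[of i] assms(1)[of "Suc i"] by auto
  qed
  have down: "g i = g (Suc i) + 1" if "i < j" for i
    using that
  proof (induction rule: strict_inc_induct)
    case (base i)
    then show ?case using step[of i] jmin[of i] j by auto
  next
    case (step i)
    then show ?case using no_peak[of i] assms(1)[of i] j by auto
  qed
  have right: "j + k \<le> d \<Longrightarrow> g (j + k) = g j + k" for k
    using up by (induction k) auto
  have left: "k \<le> j \<Longrightarrow> g (j - k) = g j + k" for k
  proof (induction k)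
    case (Suc k)
    then show ?case using down[of "j - Suc k"] by (simp add: Suc_diff_Suc)
  qed simp
  have "g i = g j + absdiff i j" if "i \<le> d" for i
    using right[of "i - j"] left[of "j - i"] that by (cases "i \<le> j") (auto simp: absdiff_def)
  with j show thesis using that by blast
qed


lemma transmission_eq:
  assumes "j \<le> d"
  shows "2 * transmission d j = j * (j + 1) + (d - j) * (d - j + 1)"
proof -
  have l: "2 * transmission j j = j * (j + 1)"
  proof -
    have "transmission j j = (\<Sum>i\<le>j. j - i)"
      unfolding transmission_def by (intro sum.cong) (auto simp: absdiff_def)
    also have "\<dots> = (\<Sum>i\<le>j. i)" using sum.nat_diff_reindex[of "\<lambda>i. i" "Suc j"]
      by (simp add: lessThan_Suc_atMost)
    finally show ?thesis using gauss_sum_nat[of j] by (simp add: atMost_atLeast0)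
  qed
  from assms show ?thesis
  proof (induction rule: dec_induct)
    case base
    then show ?case using l by simp
  next
    case (step n)
    have "transmission (Suc n) j = transmission n j + (Suc n - j)"
      using step by (simp add: transmission_def absdiff_def)
    then show ?case using step by (simp add: Suc_diff_le algebra_simps)
  qed
qed

text \<open>
  With $z = 2j - d$, four times the transmission is $d^2 + 2d + z^2$.  As $z$ has the parity of $d$,
  its square is least exactly for the one or two middle positions.
\<close>

lemma transmission_minimal:
  assumes "j \<le> d"
  shows "transmission d (d div 2) \<le> transmission d j"
    and "transmission d j = transmission d (d div 2) \<Longrightarrow> j = d div 2 \<or> j = d - d div 2"
proof -
  define z where "z j = 2 * int j - int d" for j
  have S: "4 * int (transmission d j) = (int d)\<^sup>2 + 2 * int d + (z j)\<^sup>2" if "j \<le> d" for j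
  proof -
    obtain k where d: "d = j + k" using \<open>j \<le> d\<close> le_Suc_ex by blast
    have "2 * transmission d j = j * (j + 1) + k * (k + 1)" using transmission_eq[OF \<open>j \<le> d\<close>] d by simp
    then have "2 * int (transmission d j) = int j * (int j + 1) + int k * (int k + 1)"
      by (metis (mono_tags, lifting) of_nat_1 of_nat_add of_nat_mult of_nat_numeral)
    then show ?thesis by (simp add: z_def d power2_eq_square algebra_simps)
  qed
  have z2: "(z (d div 2))\<^sup>2 = int (d mod 2)"
  proof -
    have "z (d div 2) = - int (d mod 2)"
      unfolding z_def by (simp add: minus_mod_eq_mult_div[symmetric] zmod_int zdiv_int)
    moreover have "d mod 2 = 0 \<or> d mod 2 = 1" by auto
    ultimately show ?thesis by auto
  qed
  have zj: "(z j)\<^sup>2 \<ge> int (d mod 2) \<and> ((z j)\<^sup>2 = int (d mod 2) \<longrightarrow> j = d div 2 \<or> j = d - d div 2)"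
  proof (cases "\<bar>z j\<bar> \<le> 1")
    case True
    then have "j = d div 2 \<or> j = d - d div 2" unfolding z_def using assms by arith
    moreover have "z (d - d div 2) = - z (d div 2)" unfolding z_def by (simp add: of_nat_diff)
    ultimately have "(z j)\<^sup>2 = (z (d div 2))\<^sup>2" by auto
    with z2 \<open>j = d div 2 \<or> j = d - d div 2\<close> show ?thesis by simp
  next
    case False
    then have "(z j)\<^sup>2 > 1" by (metis abs_1 abs_square_less_1 abs_square_le_1 not_le)
    moreover have "int (d mod 2) \<le> 1" by simp
    ultimately show ?thesis by linarith
  qed
  have Sj: "4 * int (transmission d j) = (int d)\<^sup>2 + 2 * int d + (z j)\<^sup>2"
    and Sm: "4 * int (transmission d (d div 2)) = (int d)\<^sup>2 + 2 * int d + int (d mod 2)"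
    using S[OF assms] S[of "d div 2"] z2 by simp_all
  show "transmission d (d div 2) \<le> transmission d j"
    using Sj Sm zj by linarith
  show "j = d div 2 \<or> j = d - d div 2" if "transmission d j = transmission d (d div 2)"
    using that Sj Sm zj by auto
qed

section \<open>Tree metrics and their total distance\<close>

lemma sum_off_diagonal:
  "finite R \<Longrightarrow> (\<Sum>x\<in>R. \<Sum>y\<in>R. if x = y then 0 else (2::nat)) = 2 * card R * (card R - 1)"
proof -
  assume R: "finite R"
  have "(\<Sum>y\<in>R. if x = y then 0 else (2::nat)) = 2 * (card R - 1)" if "x \<in> R" for x
  proof -
    have "(\<Sum>y\<in>R. if x = y then 0 else (2::nat)) = (\<Sum>y\<in>R - {x}. if x = y then 0 else 2)"
      using that R by (subst sum.remove[of R x]) auto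
    also have "\<dots> = (\<Sum>y\<in>R - {x}. 2)" by (intro sum.cong) auto
    finally show ?thesis using that R by simp
  qed
  then show ?thesis by simp
qed

text \<open>
  The value of the total distance over ordered pairs when \<open>r\<close> nodes are attached to the middle of the
  path: pairs on the path, pairs between the path and the rest, and pairs of leaves, which are at
  distance 2.
\<close>

definition minimal_total :: "nat \<Rightarrow> nat \<Rightarrow> nat" where
  "minimal_total d r = (\<Sum>i\<le>d. \<Sum>j\<le>d. absdiff i j)
     + 2 * (r * ((d + 1) + transmission d (d div 2))) + 2 * r * (r - 1)"

text \<open>
  The conditions are local, so that they can be checked edge by edge: crossing an edge changes the distance to any node
  by exactly one, and there is exactly one way to get closer.  Adjacency is distance 1.
\<close>

locale tree_metric =
  fixes V :: "'a set" and \<delta> :: "'a \<Rightarrow> 'a \<Rightarrow> nat"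
  assumes finite_V: "finite V"
    and zero_iff: "u \<in> V \<Longrightarrow> v \<in> V \<Longrightarrow> \<delta> u v = 0 \<longleftrightarrow> u = v"
    and sym: "u \<in> V \<Longrightarrow> v \<in> V \<Longrightarrow> \<delta> u v = \<delta> v u"
    and adj: "u \<in> V \<Longrightarrow> v \<in> V \<Longrightarrow> w \<in> V \<Longrightarrow> \<delta> u w = 1 \<Longrightarrow>
      \<delta> w v = \<delta> u v + 1 \<or> \<delta> u v = \<delta> w v + 1"
    and ex1_closer: "u \<in> V \<Longrightarrow> v \<in> V \<Longrightarrow> u \<noteq> v \<Longrightarrow>
      \<exists>!w. w \<in> V \<and> \<delta> u w = 1 \<and> \<delta> u v = \<delta> w v + 1"
begin

lemma closer_unique:
  assumes "u \<in> V" "v \<in> V" "w \<in> V" "\<delta> u w = 1" "\<delta> u v = \<delta> w v + 1"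
    "w' \<in> V" "\<delta> u w' = 1" "\<delta> u v = \<delta> w' v + 1"
  shows "w = w'"
proof -
  have "u \<noteq> v" using assms zero_iff[of u v] by auto
  then show ?thesis using ex1_closer[of u v] assms by blast
qed

lemma triangle: "u \<in> V \<Longrightarrow> v \<in> V \<Longrightarrow> w \<in> V \<Longrightarrow> \<delta> u w \<le> \<delta> u v + \<delta> v w"
proof (induction "\<delta> u v" arbitrary: u)
  case 0
  then show ?case using zero_iff[of u v] by auto
next
  case (Suc n)
  then obtain x where x: "x \<in> V" "\<delta> u x = 1" "\<delta> u v = \<delta> x v + 1"
    using ex1_closer[of u v] zero_iff[of u v] by auto
  have "\<delta> x w \<le> \<delta> x v + \<delta> v w" using Suc x by auto
  moreover have "\<delta> u w \<le> \<delta> x w + 1" using adj[of u w x] Suc x by auto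
  ultimately show ?case using x by auto
qed

definition geodesic :: "(nat \<Rightarrow> 'a) \<Rightarrow> nat \<Rightarrow> bool" where
  "geodesic f d \<longleftrightarrow> (\<forall>i\<le>d. f i \<in> V) \<and> (\<forall>i\<le>d. \<forall>j\<le>d. \<delta> (f i) (f j) = absdiff i j)"

lemma geodesic_inj_on: "geodesic f d \<Longrightarrow> inj_on f {..d}"
proof (rule inj_onI)
  fix i j assume "geodesic f d" "i \<in> {..d}" "j \<in> {..d}" "f i = f j"
  then have "f i \<in> V" "\<delta> (f i) (f j) = absdiff i j" unfolding geodesic_def by blast+
  then have "absdiff i j = 0" using zero_iff[of "f i" "f j"] \<open>f i = f j\<close> by simp
  then show "i = j" by (simp add: absdiff_def)
qed

lemma geodesic_rev:
  assumes "geodesic f d"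
  shows "geodesic (\<lambda>i. f (d - i)) d"
  using assms unfolding geodesic_def by (auto simp: absdiff_def)

text \<open>
  Iterate the step to the closer neighbour.  The distances between intermediate nodes are forced by
  the triangle inequality, since the total length is used up.
\<close>

lemma ex_geodesic:
  "u \<in> V \<Longrightarrow> v \<in> V \<Longrightarrow> \<exists>f. geodesic f (\<delta> u v) \<and> f 0 = u \<and> f (\<delta> u v) = v"
proof (induction "\<delta> u v" arbitrary: u)
  case 0
  then have "u = v" using zero_iff by auto
  with 0 show ?case by (intro exI[of _ "\<lambda>_. u"]) (auto simp: geodesic_def absdiff_def)
next
  case (Suc n)
  then obtain w where w: "w \<in> V" "\<delta> u w = 1" "\<delta> u v = \<delta> w v + 1"
    using ex1_closer[of u v] zero_iff[of u v] by auto
  then obtain f where f: "geodesic f n" "f 0 = w" "f n = v"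
    using Suc by (metis Suc_eq_plus1 add_right_cancel)
  have fV: "f i \<in> V" if "i \<le> n" for i using f that by (auto simp: geodesic_def)
  have fd: "\<delta> (f i) (f j) = absdiff i j" if "i \<le> n" "j \<le> n" for i j
    using f that by (auto simp: geodesic_def)
  have uf: "\<delta> u (f j) = Suc j" if "j \<le> n" for j
  proof -
    have "\<delta> u (f j) \<le> 1 + j"
      using triangle[of u w "f j"] w fd[of 0 j] f that fV[of j] Suc.prems by (auto simp: absdiff_def)
    moreover have "Suc n \<le> \<delta> u (f j) + (n - j)"
      using triangle[of u "f j" v] fd[of j n] f that fV[of j] Suc by (auto simp: absdiff_def)
    ultimately show ?thesis using that by auto
  qed
  define g where "g = case_nat u f"
  have "geodesic g (Suc n)"
    unfolding geodesic_def
  proof (intro conjI allI impI)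
    fix i j assume i: "i \<le> Suc n" and j: "j \<le> Suc n"
    show "g i \<in> V" using i fV Suc.prems by (auto simp: g_def split: nat.split)
    show "\<delta> (g i) (g j) = absdiff i j"
      using i j fd uf sym[OF fV Suc.prems(1)] zero_iff[of u u] Suc.prems
      by (auto simp: g_def absdiff_def split: nat.split)
  qed
  moreover have "g 0 = u" "g (Suc n) = v" using f by (auto simp: g_def)
  ultimately show ?case using Suc.hyps(2) by metis
qed

definition branch :: "(nat \<Rightarrow> 'a) \<Rightarrow> nat \<Rightarrow> 'a set" where
  "branch f d = V - f ` {..d}"

lemma finite_branch: "finite (branch f d)"
  using finite_V by (simp add: branch_def)

text \<open>
  A peak of the distance along the path would be a node with two different neighbours closer to
  \<open>x\<close>.
\<close>

lemma distances_to_geodesic: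
  assumes f: "geodesic f d" and x: "x \<in> V"
  obtains j where "j \<le> d" "\<And>i. i \<le> d \<Longrightarrow> \<delta> x (f i) = \<delta> x (f j) + absdiff i j"
proof -
  have fV: "\<And>i. i \<le> d \<Longrightarrow> f i \<in> V" 
    and fd: "\<And>i j. i \<le> d \<Longrightarrow> j \<le> d \<Longrightarrow> \<delta> (f i) (f j) = absdiff i j"
    using f by (auto simp: geodesic_def)
  have fd1: "\<delta> (f i) (f (Suc i)) = 1" "\<delta> (f (Suc i)) (f i) = 1" if "i < d" for i
    using fd[of i "Suc i"] fd[of "Suc i" i] that by (simp_all add: absdiff_def)
  have st: "\<delta> x (f (Suc i)) = \<delta> x (f i) + 1 \<or> \<delta> x (f i) = \<delta> x (f (Suc i)) + 1" if "i < d" for i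
    using adj[of "f i" x "f (Suc i)"] fV[of i] fV[of "Suc i"] fd1[of i] x that
      sym[of x "f i"] sym[of x "f (Suc i)"] by auto
  have pk: "\<delta> x (f (Suc i)) \<noteq> \<delta> x (f (Suc (Suc i))) + 1"
    if i: "Suc i < d" and up: "\<delta> x (f (Suc i)) = \<delta> x (f i) + 1" for i
  proof
    assume "\<delta> x (f (Suc i)) = \<delta> x (f (Suc (Suc i))) + 1"
    then have "f i = f (Suc (Suc i))"
      using closer_unique[of "f (Suc i)" x "f i" "f (Suc (Suc i))"] up i x
        fV[of i] fV[of "Suc i"] fV[of "Suc (Suc i)"] fd1[of i] fd1[of "Suc i"]
        sym[of x "f i"] sym[of x "f (Suc i)"] sym[of x "f (Suc (Suc i))"] by auto
    then have "i = Suc (Suc i)" by (rule inj_onD[OF geodesic_inj_on[OF f]]) (use i in auto)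
    then show False by simp
  qed
  show thesis
    by (rule v_shaped_sequence[of d "\<lambda>i. \<delta> x (f i)"]) (fact st pk that)+
qed

text \<open>
  Encoded as a number (0 if the node is adjacent to the path, 1 otherwise), so that these values can
  be summed to count the nodes far from the path.
\<close>

definition off_path :: "(nat \<Rightarrow> 'a) \<Rightarrow> nat \<Rightarrow> 'a \<Rightarrow> nat" where
  "off_path f d x = (if \<exists>i\<le>d. \<delta> x (f i) = 1 then 0 else 1)"

text \<open>
  The node \<open>j\<close> of the path closest to \<open>x\<close> contributes its transmission, and the height of \<open>x\<close> above
  the path is counted $d + 1$ times.  A node not adjacent to the path has height at
  least 2 and therefore a surplus of $d + 1 \ge 3$.
\<close>

lemma sum_distances_to_geodesic:
  assumes f: "geodesic f d" and d: "2 \<le> d" and x: "x \<in> branch f d"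
  shows "(d + 1) + transmission d (d div 2) + 3 * off_path f d x \<le> (\<Sum>i\<le>d. \<delta> x (f i))"
    and "off_path f d x = 0 \<Longrightarrow>
      (\<Sum>i\<le>d. \<delta> x (f i)) = (d + 1) + transmission d (d div 2) \<Longrightarrow>
      \<exists>j. (j = d div 2 \<or> j = d - d div 2) \<and> (\<forall>i\<le>d. \<delta> x (f i) = 1 + absdiff i j)"
proof -
  have xV: "x \<in> V" using x by (simp add: branch_def)
  obtain j where j: "j \<le> d" and dj: "\<And>i. i \<le> d \<Longrightarrow> \<delta> x (f i) = \<delta> x (f j) + absdiff i j"
    using distances_to_geodesic[OF f xV] by blast
  have pos: "1 \<le> \<delta> x (f j)"
    using x j f zero_iff[of x "f j"] by (force simp: branch_def geodesic_def Suc_le_eq)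
  have far: "1 + off_path f d x \<le> \<delta> x (f j)"
    using pos j by (fastforce simp: off_path_def)
  have sum: "(\<Sum>i\<le>d. \<delta> x (f i)) = (d + 1) * \<delta> x (f j) + transmission d j"
    using dj by (simp add: sum.distrib transmission_def)
  have "(d + 1) * (1 + off_path f d x) \<le> (d + 1) * \<delta> x (f j)" using far by (rule mult_le_mono2)
  moreover have "3 * off_path f d x \<le> (d + 1) * off_path f d x" using d by (intro mult_le_mono1) simp
  moreover have "(d + 1) * (1 + off_path f d x) = (d + 1) + (d + 1) * off_path f d x" by simp
  ultimately show "(d + 1) + transmission d (d div 2) + 3 * off_path f d x \<le> (\<Sum>i\<le>d. \<delta> x (f i))"
    using sum transmission_minimal(1)[OF j] by linarith
  assume z: "off_path f d x = 0"
    and eq: "(\<Sum>i\<le>d. \<delta> x (f i)) = (d + 1) + transmission d (d div 2)"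
  obtain i where "i \<le> d" "\<delta> x (f i) = 1" using z by (auto simp: off_path_def split: if_splits)
  then have one: "\<delta> x (f j) = 1" using dj[of i] pos by simp
  then have "transmission d j = transmission d (d div 2)" using sum eq by simp
  then have "j = d div 2 \<or> j = d - d div 2" by (rule transmission_minimal(2)[OF j])
  then show "\<exists>j. (j = d div 2 \<or> j = d - d div 2) \<and> (\<forall>i\<le>d. \<delta> x (f i) = 1 + absdiff i j)"
    using dj one by auto
qed

text \<open>
  The tree is rooted at the start of the path.
\<close>

definition parent :: "(nat \<Rightarrow> 'a) \<Rightarrow> 'a \<Rightarrow> 'a \<Rightarrow> bool" where
  "parent f x y \<longleftrightarrow> \<delta> x y = 1 \<and> \<delta> x (f 0) = \<delta> y (f 0) + 1"

lemma two_le_distance: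
  assumes "f 0 \<in> V" "x \<in> V" "y \<in> V" "x \<noteq> y"
  shows "2 \<le> \<delta> x y + of_bool (parent f x y) + of_bool (parent f y x)"
proof (cases "\<delta> x y = 1")
  case True
  then have "parent f x y \<or> parent f y x"
    using adj[of x "f 0" y] sym[of x y] assms by (auto simp: parent_def)
  with True show ?thesis by auto
next
  case False
  then show ?thesis using zero_iff[of x y] assms by (cases "\<delta> x y") auto
qed

text \<open>
  If \<open>x\<close> is adjacent to the path, then its parent lies on the path: otherwise \<open>x\<close> itself would be the
  parent of a path node, but that parent is the preceding path node.
\<close>

lemma parent_in_branch_imp_off_path:
  assumes f: "geodesic f d" and x: "x \<in> branch f d" and y: "y \<in> branch f d" and p: "parent f x y"
  shows "off_path f d x = 1"
proof -
  have fV: "\<And>i. i \<le> d \<Longrightarrow> f i \<in> V" 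
    and fd: "\<And>i j. i \<le> d \<Longrightarrow> j \<le> d \<Longrightarrow> \<delta> (f i) (f j) = absdiff i j"
    using f by (auto simp: geodesic_def)
  have fR: "f i \<notin> branch f d" if "i \<le> d" for i using that by (auto simp: branch_def)
  have xV: "x \<in> V" and yV: "y \<in> V" using x y by (simp_all add: branch_def)
  have "\<delta> x (f i) \<noteq> 1" if i: "i \<le> d" for i
  proof
    assume a: "\<delta> x (f i) = 1"
    have a': "\<delta> (f i) x = 1" using a sym[of x "f i"] xV fV[OF i] by simp
    have i0: "\<delta> (f i) (f 0) = i" using fd[of i 0] i by (simp add: absdiff_def)
    consider "i = \<delta> x (f 0) + 1" | "\<delta> x (f 0) = \<delta> (f i) (f 0) + 1"
      using adj[of x "f 0" "f i"] a xV fV[of 0] fV[OF i] i0 by auto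
    then show False
    proof cases
      case 1
      have "x = f (i - 1)"
      proof (rule closer_unique[of "f i" "f 0"])
        show "\<delta> (f i) (f (i - 1)) = 1" "\<delta> (f i) (f 0) = \<delta> (f (i - 1)) (f 0) + 1"
          using fd[of "i - 1" 0] fd[of i "i - 1"] i0 i 1 by (auto simp: absdiff_def)
      qed (use 1 a' i0 xV fV i in auto)
      then show False using fR[of "i - 1"] x i by simp
    next
      case 2
      then have "f i = y"
        using closer_unique[of x "f 0" "f i" y] p a xV yV fV[of 0] fV[OF i] by (auto simp: parent_def)
      then show False using fR[OF i] y by simp
    qed
  qed
  then show ?thesis by (auto simp: off_path_def)
qed

text \<open>
  Parents are unique, so this sum is 0 or 1.
\<close>

lemma sum_parents:
  assumes f: "geodesic f d" and x: "x \<in> branch f d"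
  shows "(\<Sum>y\<in>branch f d. of_bool (parent f x y)) \<le> off_path f d x"
proof (cases "\<exists>y\<in>branch f d. parent f x y")
  case False
  then show ?thesis by simp
next
  case True
  then obtain y where y: "y \<in> branch f d" "parent f x y" by blast
  have "f 0 \<in> V" using f by (simp add: geodesic_def)
  then have uniq: "z = y" if "z \<in> branch f d" "parent f x z" for z
    using closer_unique[of x "f 0" z y] that y x by (auto simp: parent_def branch_def)
  have "(\<Sum>y'\<in>branch f d. of_bool (parent f x y')) = (\<Sum>y'\<in>branch f d. if y' = y then 1 else (0::nat))"
  proof (rule sum.cong)
    fix y' assume "y' \<in> branch f d"
    then have "parent f x y' \<longleftrightarrow> y' = y" using uniq y by blast
    then show "of_bool (parent f x y') = (if y' = y then 1 else (0::nat))" by simp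
  qed simp
  then have "(\<Sum>y'\<in>branch f d. of_bool (parent f x y')) = (1::nat)"
    using y finite_branch by simp
  then show ?thesis using parent_in_branch_imp_off_path[OF f x y] by simp
qed

text \<open>
  Every adjacent pair is a pair of a child and its parent, so the defect of 1 with respect to distance 2
  can be charged to the child.  Each edge occurs as two ordered pairs, hence the factor 2.
\<close>

lemma sum_distances_branch:
  assumes f: "geodesic f d"
  defines "R \<equiv> branch f d"
  shows "(\<Sum>x\<in>R. \<Sum>y\<in>R. if x = y then 0 else 2) \<le> (\<Sum>x\<in>R. \<Sum>y\<in>R. \<delta> x y) + 2 * (\<Sum>x\<in>R. off_path f d x)"
proof -
  have RV: "x \<in> V" if "x \<in> R" for x using that by (simp add: R_def branch_def)
  have f0: "f 0 \<in> V" using f by (simp add: geodesic_def)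
  let ?p = "\<Sum>x\<in>R. \<Sum>y\<in>R. of_bool (parent f x y) :: nat"
  have "(\<Sum>x\<in>R. \<Sum>y\<in>R. if x = y then 0 else 2)
      \<le> (\<Sum>x\<in>R. \<Sum>y\<in>R. \<delta> x y + of_bool (parent f x y) + of_bool (parent f y x))"
    using two_le_distance[of f, OF f0 RV RV] by (intro sum_mono) auto
  also have "\<dots> = (\<Sum>x\<in>R. \<Sum>y\<in>R. \<delta> x y) + ?p + (\<Sum>x\<in>R. \<Sum>y\<in>R. of_bool (parent f y x))"
    by (simp only: sum.distrib)
  also have "(\<Sum>x\<in>R. \<Sum>y\<in>R. of_bool (parent f y x)) = ?p"
    by (rule sum.swap)
  finally have "(\<Sum>x\<in>R. \<Sum>y\<in>R. if x = y then 0 else 2) \<le> (\<Sum>x\<in>R. \<Sum>y\<in>R. \<delta> x y) + ?p + ?p" .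
  moreover have "?p \<le> (\<Sum>x\<in>R. off_path f d x)"
    using sum_parents[OF f] unfolding R_def by (rule sum_mono)
  ultimately show ?thesis by linarith
qed

definition total_distance :: nat where
  "total_distance = (\<Sum>u\<in>V. \<Sum>v\<in>V. \<delta> u v)"

lemma total_distance_split:
  assumes f: "geodesic f d"
  defines "R \<equiv> branch f d"
  shows "total_distance = (\<Sum>i\<le>d. \<Sum>j\<le>d. absdiff i j) + 2 * (\<Sum>x\<in>R. \<Sum>i\<le>d. \<delta> x (f i))
    + (\<Sum>x\<in>R. \<Sum>y\<in>R. \<delta> x y)"
proof -
  let ?S = "f ` {..d}"
  have fV: "\<And>i. i \<le> d \<Longrightarrow> f i \<in> V" 
    and fd: "\<And>i j. i \<le> d \<Longrightarrow> j \<le> d \<Longrightarrow> \<delta> (f i) (f j) = absdiff i j"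
    using f by (auto simp: geodesic_def)
  have RV: "x \<in> V" if "x \<in> R" for x using that by (simp add: R_def branch_def)
  have V: "V = ?S \<union> R" "?S \<inter> R = {}" "finite R" using fV by (auto simp: R_def branch_def finite_V)
  have split: "(\<Sum>v\<in>V. h v) = (\<Sum>i\<le>d. h (f i)) + (\<Sum>v\<in>R. h v)" for h :: "'a \<Rightarrow> nat"
  proof -
    have "(\<Sum>v\<in>V. h v) = (\<Sum>v\<in>?S. h v) + (\<Sum>v\<in>R. h v)"
      using V by (metis finite_atMost finite_imageI sum.union_disjoint)
    then show ?thesis by (simp add: sum.reindex[OF geodesic_inj_on[OF f]])
  qed
  have "total_distance = (\<Sum>i\<le>d. \<Sum>j\<le>d. \<delta> (f i) (f j)) + (\<Sum>i\<le>d. \<Sum>x\<in>R. \<delta> (f i) x)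
      + ((\<Sum>x\<in>R. \<Sum>i\<le>d. \<delta> x (f i)) + (\<Sum>x\<in>R. \<Sum>y\<in>R. \<delta> x y))"
    unfolding total_distance_def by (simp add: split sum.distrib)
  moreover have "(\<Sum>i\<le>d. \<Sum>j\<le>d. \<delta> (f i) (f j)) = (\<Sum>i\<le>d. \<Sum>j\<le>d. absdiff i j)"
    using fd by (intro sum.cong) auto
  moreover have "(\<Sum>i\<le>d. \<Sum>x\<in>R. \<delta> (f i) x) = (\<Sum>x\<in>R. \<Sum>i\<le>d. \<delta> x (f i))"
    using fV RV sym by (subst sum.swap) (intro sum.cong, auto)
  ultimately show ?thesis by simp
qed

text \<open>
  All distances are determined: the remaining nodes are leaves attached to the middle of the path.
\<close>

definition broom :: "(nat \<Rightarrow> 'a) \<Rightarrow> nat \<Rightarrow> bool" where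
  "broom f d \<longleftrightarrow> geodesic f d \<and>
     (\<forall>x\<in>branch f d. \<forall>i\<le>d. \<delta> x (f i) = 1 + absdiff i (d div 2)) \<and>
     (\<forall>x\<in>branch f d. \<forall>y\<in>branch f d. x \<noteq> y \<longrightarrow> \<delta> x y = 2)"

lemma card_branch: "geodesic f d \<Longrightarrow> card (branch f d) = card V - (d + 1)"
  unfolding branch_def
  by (subst card_Diff_subset) (auto simp: geodesic_def card_image[OF geodesic_inj_on])

lemma total_distance_broom:
  assumes "broom f d"
  shows "total_distance = minimal_total d (card V - (d + 1))"
proof -
  let ?R = "branch f d"
  have f: "geodesic f d" using assms by (simp add: broom_def)
  have "(\<Sum>i\<le>d. \<delta> x (f i)) = (d + 1) + transmission d (d div 2)" if "x \<in> ?R" for x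
  proof -
    have "(\<Sum>i\<le>d. \<delta> x (f i)) = (\<Sum>i\<le>d. 1 + absdiff i (d div 2))"
      using assms that by (intro sum.cong) (auto simp: broom_def)
    then show ?thesis by (simp only: sum.distrib transmission_def) simp
  qed
  then have path: "(\<Sum>x\<in>?R. \<Sum>i\<le>d. \<delta> x (f i)) = card ?R * ((d + 1) + transmission d (d div 2))"
    by simp
  have pairs: "(\<Sum>x\<in>?R. \<Sum>y\<in>?R. \<delta> x y) = (\<Sum>x\<in>?R. \<Sum>y\<in>?R. if x = y then 0 else 2)"
    using assms zero_iff by (intro sum.cong refl) (auto simp: broom_def branch_def)
  show ?thesis
    unfolding total_distance_split[OF f] minimal_total_def card_branch[OF f, symmetric]
      path pairs sum_off_diagonal[OF finite_branch] ..
qed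

text \<open>
  For odd $d$ there are two central positions at distance 1.  Leaves attached to both of them would
  have distance 3 instead of 2, so one position is used by all leaves, and reversing the path turns
  it into \<open>d div 2\<close>.
\<close>

lemma broom_if_central:
  assumes f: "geodesic f d"
    and central: "\<And>x. x \<in> branch f d \<Longrightarrow>
      \<exists>j. (j = d div 2 \<or> j = d - d div 2) \<and> (\<forall>i\<le>d. \<delta> x (f i) = 1 + absdiff i j)"
    and two: "\<And>x y. x \<in> branch f d \<Longrightarrow> y \<in> branch f d \<Longrightarrow> x \<noteq> y \<Longrightarrow> \<delta> x y = 2"
  shows "\<exists>g. broom g d"
proof (cases "\<forall>x\<in>branch f d. \<forall>i\<le>d. \<delta> x (f i) = 1 + absdiff i (d div 2)")
  case True
  then show ?thesis using f two by (auto simp: broom_def)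
next
  case False
  then obtain x where x: "x \<in> branch f d"
    and notm: "\<not> (\<forall>i\<le>d. \<delta> x (f i) = 1 + absdiff i (d div 2))" by blast
  then have xm: "\<And>i. i \<le> d \<Longrightarrow> \<delta> x (f i) = 1 + absdiff i (d - d div 2)" and ne: "d - d div 2 \<noteq> d div 2"
    using central[OF x] by auto
  have all: "\<delta> y (f i) = 1 + absdiff i (d - d div 2)" if y: "y \<in> branch f d" and i: "i \<le> d" for y i
  proof (rule ccontr)
    assume "\<not> ?thesis"
    then have ym: "\<And>i. i \<le> d \<Longrightarrow> \<delta> y (f i) = 1 + absdiff i (d div 2)" and xy: "x \<noteq> y"
      using central[OF y] xm i by auto
    have V: "x \<in> V" "y \<in> V" "f (d div 2) \<in> V" using x y f by (auto simp: branch_def geodesic_def)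
    have "\<delta> y (f (d div 2)) = 1" using ym[of "d div 2"] by (simp add: absdiff_def)
    then have "\<delta> (f (d div 2)) x = \<delta> y x + 1 \<or> \<delta> y x = \<delta> (f (d div 2)) x + 1"
      using adj[of y x "f (d div 2)"] V by simp
    moreover have "\<delta> (f (d div 2)) x = 2"
      using xm[of "d div 2"] ne sym[of "f (d div 2)" x] V by (simp add: absdiff_def) arith
    ultimately show False using two[OF y x] xy by auto
  qed
  have "branch (\<lambda>i. f (d - i)) d = branch f d"
  proof -
    have "(\<lambda>i. f (d - i)) ` {..d} = f ` {..d}"
    proof (intro equalityI subsetI)
      fix x assume "x \<in> f ` {..d}"
      then obtain i where "x = f i" "i \<le> d" by blast
      then show "x \<in> (\<lambda>i. f (d - i)) ` {..d}" by (intro image_eqI[of _ _ "d - i"]) auto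
    qed auto
    then show ?thesis by (simp add: branch_def)
  qed
  then have "broom (\<lambda>i. f (d - i)) d"
    using geodesic_rev[OF f] two all by (auto simp: broom_def absdiff_def)
  then show ?thesis by blast
qed

text \<open>
  A node not adjacent to the path raises the sum of its distances to the path by at least 3, which
  counts twice among ordered pairs, and saves at most 2 among the pairs of remaining nodes.
\<close>

lemma total_distance_ge:
  assumes f: "geodesic f d" and d: "2 \<le> d"
  shows "minimal_total d (card V - (d + 1)) \<le> total_distance"
    and "total_distance = minimal_total d (card V - (d + 1)) \<Longrightarrow> \<exists>g. broom g d"
proof -
  let ?R = "branch f d"
  let ?b = "(d + 1) + transmission d (d div 2)"
  let ?off = "\<Sum>x\<in>?R. off_path f d x"
  let ?path = "\<Sum>x\<in>?R. \<Sum>i\<le>d. \<delta> x (f i)"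
  let ?pairs = "\<Sum>x\<in>?R. \<Sum>y\<in>?R. \<delta> x y"
  let ?two = "\<Sum>x\<in>?R. \<Sum>y\<in>?R. if x = y then 0 else (2::nat)"
  have "(\<Sum>x\<in>?R. ?b + 3 * off_path f d x) \<le> ?path"
    using sum_distances_to_geodesic(1)[OF f d] by (rule sum_mono)
  then have path: "card ?R * ?b + 3 * ?off \<le> ?path"
    unfolding sum.distrib[of "\<lambda>_. ?b"] sum_distrib_left sum_constant by simp
  have pairs: "?two \<le> ?pairs + 2 * ?off"
    by (rule sum_distances_branch[OF f])
  have tot: "total_distance = (\<Sum>i\<le>d. \<Sum>j\<le>d. absdiff i j) + 2 * ?path + ?pairs"
    by (rule total_distance_split[OF f])
  have mt: "minimal_total d (card V - (d + 1)) = (\<Sum>i\<le>d. \<Sum>j\<le>d. absdiff i j) + 2 * (card ?R * ?b) + ?two"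
    by (simp only: minimal_total_def card_branch[OF f, symmetric] sum_off_diagonal[OF finite_branch])
  show "minimal_total d (card V - (d + 1)) \<le> total_distance"
    using tot mt path pairs by linarith
  assume eq: "total_distance = minimal_total d (card V - (d + 1))"
  have off0: "?off = 0" and path_eq: "?path = card ?R * ?b" and pairs_eq: "?pairs = ?two"
    using tot mt path pairs eq by linarith+
  have off: "off_path f d x = 0" if "x \<in> ?R" for x
    using off0 that finite_branch by simp
  have sum_b: "(\<Sum>i\<le>d. \<delta> x (f i)) = ?b" if x: "x \<in> ?R" for x
  proof -
    have "(\<Sum>x\<in>?R. ?b) = ?path" using path_eq by simp
    moreover have "?b \<le> (\<Sum>i\<le>d. \<delta> z (f i))" if "z \<in> ?R" for z
      using sum_distances_to_geodesic(1)[OF f d that] by linarith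
    ultimately show ?thesis
      using sum_mono_inv[of "\<lambda>_. ?b" ?R "\<lambda>x. \<Sum>i\<le>d. \<delta> x (f i)" x] x finite_branch by metis
  qed
  have central: "\<exists>j. (j = d div 2 \<or> j = d - d div 2) \<and> (\<forall>i\<le>d. \<delta> x (f i) = 1 + absdiff i j)"
    if "x \<in> ?R" for x
    using sum_distances_to_geodesic(2)[OF f d that off[OF that] sum_b[OF that]] .
  have no_parent: "\<not> parent f x y" if "x \<in> ?R" "y \<in> ?R" for x y
    using parent_in_branch_imp_off_path[OF f that] off[OF that(1)] by auto
  have ge: "(if x = y then 0 else 2) \<le> \<delta> x y" if "x \<in> ?R" "y \<in> ?R" for x y
    using two_le_distance[of f x y] no_parent that f by (auto simp: branch_def geodesic_def)
  have "(\<Sum>y\<in>?R. if x = y then 0 else 2) = (\<Sum>y\<in>?R. \<delta> x y)" if "x \<in> ?R" for x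
    by (rule sum_mono_inv[OF pairs_eq[symmetric] _ that finite_branch]) (use ge in \<open>auto intro!: sum_mono\<close>)
  then have "(if x = y then 0 else 2) = \<delta> x y" if "x \<in> ?R" "y \<in> ?R" for x y
    using sum_mono_inv[of "\<lambda>y. if x = y then 0 else 2" ?R "\<delta> x" y] ge that finite_branch by blast
  then have "\<delta> x y = 2" if "x \<in> ?R" "y \<in> ?R" "x \<noteq> y" for x y
    using that by metis
  then show "\<exists>g. broom g d" using broom_if_central[OF f central] by blast
qed

end

section \<open>Undirected trees and tree metrics\<close>

text \<open>
  A walk back that avoids the edge contains a simple path, which the edge closes to a cycle of length
  at least 3.
\<close>

lemma (in pair_graph) bridge:
  assumes acyclic: "\<not> (\<exists>p. cycle p \<and> 3 \<le> length p)"
    and arc: "(u, a) \<in> parcs G" and walk: "awalk a p u"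
  shows "(a, u) \<in> set p \<or> (u, a) \<in> set p"
proof (rule ccontr)
  assume avoid: "\<not> ?thesis"
  define q where "q = awalk_to_apath p"
  have q: "apath a q u" and sub: "set q \<subseteq> set p"
    using apath_awalk_to_apath[OF walk] awalk_to_apath_subset[OF walk] by (simp_all add: q_def)
  have "u \<noteq> a" using arc no_loops' by blast
  have len: "2 \<le> length q"
  proof (rule ccontr)
    assume "\<not> 2 \<le> length q"
    then consider "q = []" | e where "q = [e]" by (cases q; cases "tl q") auto
    then show False
    proof cases
      case 1
      then show ?thesis using q \<open>u \<noteq> a\<close> by (simp add: apath_Nil_iff)
    next
      case 2
      then have "e = (a, u)" using q by (auto simp: apath_simps intro: prod_eqI)
      then show ?thesis using 2 sub avoid by simp
    qed
  qed
  have "awalk u ((u, a) # q) u" using q arc by (auto simp: awalk_Cons_iff apath_def)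
  moreover have "distinct (tl (awalk_verts u ((u, a) # q)))" using q by (simp add: apath_def)
  ultimately have "cycle ((u, a) # q)" unfolding cycle_def by blast
  then show False using acyclic len by force
qed

text \<open>
  At the first place where two paths leave a common node \<open>u\<close> along different edges, going along one
  path and back along the other leads around the first edge, although every edge is a bridge.
\<close>

lemma (in pair_graph) apath_unique:
  assumes acyclic: "\<not> (\<exists>p. cycle p \<and> 3 \<le> length p)"
  shows "apath u p v \<Longrightarrow> apath u q v \<Longrightarrow> p = q"
proof (induction p arbitrary: u q)
  case Nil
  then show ?case using apath_nonempty_ends[of u q v] by (auto simp: apath_Nil_iff)
next
  case (Cons e p)
  obtain a where e: "e = (u, a)" using Cons.prems(1) by (cases e) (auto simp: apath_Cons_iff)
  have p: "apath a p v" "u \<notin> set (awalk_verts a p)" and ua: "(u, a) \<in> parcs G"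
    using Cons.prems(1) e by (auto simp: apath_Cons_iff)
  have "q \<noteq> []" using Cons.prems apath_nonempty_ends[of u "e # p" v] by (auto simp: apath_Nil_iff)
  then obtain b q' where q_eq: "q = (u, b) # q'"
    using Cons.prems(2) by (cases q) (auto simp: apath_Cons_iff)
  have q': "apath b q' v" "u \<notin> set (awalk_verts b q')" and ub: "(u, b) \<in> parcs G"
    using Cons.prems(2) q_eq by (auto simp: apath_Cons_iff)
  have "a = b"
  proof (rule ccontr)
    assume "a \<noteq> b"
    have awp: "awalk a p v" and awq: "awalk b q' v" using p q' by (auto simp: apath_def)
    have "awalk b [(b, u)] u" using ub arcs_symmetric by (auto simp: awalk_simps dest: in_arcsD1)
    then have "awalk a (p @ rev_path q' @ [(b, u)]) u"
      using awp awq by (meson awalk_appendI awalk_rev_path)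
    then have "(a, u) \<in> set (p @ rev_path q' @ [(b, u)]) \<or> (u, a) \<in> set (p @ rev_path q' @ [(b, u)])"
      by (rule bridge[OF acyclic ua])
    moreover have "(a, u) \<notin> set p" "(u, a) \<notin> set p"
      using p(2) awalk_verts_arc1[of "(u, a)" p a] awalk_verts_arc2[OF awp, of "(a, u)"] by auto
    moreover have "u \<notin> set (awalk_verts v (rev_path q'))" "awalk v (rev_path q') b"
      using awalk_verts_rev_path[OF awq] q'(2) awq by simp_all
    then have "(a, u) \<notin> set (rev_path q')" "(u, a) \<notin> set (rev_path q')"
      using awalk_verts_arc1[of "(u, a)" "rev_path q'" v]
        awalk_verts_arc2[of v "rev_path q'" b "(a, u)"] by auto
    moreover have "u \<noteq> b" using ub no_loops' by blast
    ultimately show False using \<open>a \<noteq> b\<close> by auto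
  qed
  then show ?case using Cons.IH[OF p(1)] q' e q_eq by simp
qed

lemma (in pair_graph) tree_dist_eq:
  assumes acyclic: "\<not> (\<exists>p. cycle p \<and> 3 \<le> length p)" and p: "apath u p v"
  shows "tree_dist G u v = length p"
proof -
  have "(THE p. apath u p v) = p" using p apath_unique[OF acyclic] by blast
  then show ?thesis by (simp add: tree_dist_def)
qed

text \<open>
  Let \<open>w\<close> be a neighbour of \<open>u\<close>.  The path from \<open>w\<close> to \<open>v\<close> either avoids \<open>u\<close> and extends to the path from
  \<open>u\<close> to \<open>v\<close>, or it starts with the step to \<open>u\<close>, because the path from \<open>w\<close> to \<open>u\<close> is
  unique.
\<close>

lemma tree_metric_tree_dist:
  assumes tree: "undirected_tree G"
  shows "tree_metric (pverts G) (tree_dist G)"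
    and "parcs G = {(u, v). u \<in> pverts G \<and> v \<in> pverts G \<and> tree_dist G u v = 1}"
    and "pverts G \<noteq> {}"
proof -
  interpret pair_graph G using tree by (simp add: undirected_tree_def)
  have acyclic: "\<not> (\<exists>p. cycle p \<and> 3 \<le> length p)" using tree by (simp add: undirected_tree_def)
  note dist = tree_dist_eq[OF acyclic] and unique = apath_unique[OF acyclic]
  have conn: "strongly_connected (with_proj (mk_symmetric (with_proj G)))"
    using tree by (simp add: undirected_tree_def connected_def)
  then show "pverts G \<noteq> {}" by (auto simp: strongly_connected_def)
  have ex: "\<exists>p. apath u p v" if "u \<in> pverts G" "v \<in> pverts G" for u v
    using conn that reachable_mk_symmetric_eq[OF pair_sym_arcs] reachable_apath
    by (auto simp: strongly_connected_def)
  have dist_arc: "tree_dist G u v = 1" if "(u, v) \<in> parcs G" for u v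
  proof -
    have "apath u [(u, v)] v"
      using that no_loops' by (auto simp: apath_simps dest: in_arcsD2)
    then show ?thesis using dist by fastforce
  qed
  have arc_dist: "(u, v) \<in> parcs G" if uv: "u \<in> pverts G" "v \<in> pverts G" "tree_dist G u v = 1" for u v
  proof -
    obtain p where p: "apath u p v" using ex[OF uv(1,2)] by blast
    then have "length p = 1" using dist[OF p] uv by simp
    then obtain e where "p = [e]" by (cases p) auto
    then show ?thesis using p by (cases e) (auto simp: apath_simps)
  qed
  show arcs: "parcs G = {(u, v). u \<in> pverts G \<and> v \<in> pverts G \<and> tree_dist G u v = 1}"
  proof (intro equalityI subrelI)
    fix u v assume "(u, v) \<in> parcs G"
    then show "(u, v) \<in> {(u, v). u \<in> pverts G \<and> v \<in> pverts G \<and> tree_dist G u v = 1}"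
      using dist_arc[of u v] in_arcsD1[of u v] in_arcsD2[of u v] by simp
  qed (use arc_dist in blast)
  have step: "tree_dist G w v = tree_dist G u v + 1 \<or> 
      (\<exists>q. apath w q v \<and> apath u ((u, w) # q) v \<and> tree_dist G u v = tree_dist G w v + 1)"
    if uw: "(u, w) \<in> parcs G" and v: "v \<in> pverts G" for u v w
  proof -
    obtain q where q: "apath w q v" using ex[OF in_arcsD2[OF uw] v] by blast
    show ?thesis
    proof (cases "u \<in> set (awalk_verts w q)")
      case False
      then have "apath u ((u, w) # q) v" using q uw by (simp add: apath_Cons_iff)
      then show ?thesis using dist[OF q] dist q by fastforce
    next
      case True
      then obtain q1 q2 where q12: "q = q1 @ q2" and q1: "awalk w q1 u" and q2: "awalk u q2 v"
        using awalk_decomp[of w q v u] q by (auto simp: apath_def)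
      have "awlast w q1 = u" using q1 by auto
      then have a1: "apath w q1 u" and a2: "apath u q2 v"
        using q apath_append_iff[of w q1 q2 v] q12 by auto
      have "apath w [(w, u)] u"
        using uw arcs_symmetric no_loops' by (auto simp: apath_simps dest: in_arcsD1)
      then have "length q1 = 1" using unique[OF a1] by auto
      then show ?thesis using dist[OF q] dist[OF a2] q12 by simp
    qed
  qed
  show "tree_metric (pverts G) (tree_dist G)"
  proof
    show "finite (pverts G)" by (rule pair_finite_verts)
  next
    fix u v assume u: "u \<in> pverts G" and v: "v \<in> pverts G"
    obtain p where p: "apath u p v" using ex u v by blast
    show "tree_dist G u v = 0 \<longleftrightarrow> u = v"
      using dist[OF p] p apath_nonempty_ends[OF p] by (auto simp: apath_Nil_iff)
    have "apath v (rev_path p) u" using p by simp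
    moreover have "length (rev_path p) = length p" by (induction p) auto
    ultimately show "tree_dist G u v = tree_dist G v u" using dist[OF p] dist by metis
    show "\<exists>!w. w \<in> pverts G \<and> tree_dist G u w = 1 \<and> tree_dist G u v = tree_dist G w v + 1"
      if "u \<noteq> v"
    proof -
      obtain w q where p_eq: "p = (u, w) # q"
        using p \<open>u \<noteq> v\<close> by (cases p) (auto simp: apath_simps)
      then have uw: "(u, w) \<in> parcs G" and q: "apath w q v" using p by (auto simp: apath_Cons_iff)
      show ?thesis
      proof (rule ex1I[of _ w])
        show "w \<in> pverts G \<and> tree_dist G u w = 1 \<and> tree_dist G u v = tree_dist G w v + 1"
          using in_arcsD2[OF uw] dist_arc[OF uw] dist[OF p] dist[OF q] p_eq by simp
      next
        fix z assume z: "z \<in> pverts G \<and> tree_dist G u z = 1 \<and> tree_dist G u v = tree_dist G z v + 1"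
        then have "(u, z) \<in> parcs G" using arc_dist u by blast
        from step[OF this v] z obtain q' where "apath u ((u, z) # q') v" by auto
        then show "z = w" using unique[OF p] p_eq by auto
      qed
    qed
  next
    fix u v w assume "u \<in> pverts G" "v \<in> pverts G" "w \<in> pverts G" "tree_dist G u w = 1"
    then show "tree_dist G w v = tree_dist G u v + 1 \<or> tree_dist G u v = tree_dist G w v + 1"
      using step[OF arc_dist] by blast
  qed
qed

lemma (in pair_wf_digraph) awalk_nth:
  "awalk u p v \<Longrightarrow> i < length p \<Longrightarrow> p ! i = (awalk_verts u p ! i, awalk_verts u p ! Suc i)"
proof (induction p arbitrary: u i)
  case (Cons e p)
  then have tl: "fst e = u" "awalk (snd e) p v" by (auto simp: awalk_Cons_iff)
  show ?case
  proof (cases i)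
    case 0
    have "awalk_verts (snd e) p ! 0 = snd e" by (cases p) (use tl in \<open>auto simp: awalk_Cons_iff\<close>)
    then show ?thesis using 0 tl by (cases e) simp
  next
    case (Suc j)
    then show ?thesis using Cons tl by simp
  qed
qed simp

text \<open>
  A way to recognise a tree and its distances at once.  Moving to closer neighbours gives paths of the
  right length.  On a cycle through \<open>u\<close>, a node farthest from \<open>u\<close> would have two different neighbours
  closer to \<open>u\<close>.
\<close>

lemma undirected_tree_if_tree_metric:
  assumes ne: "pverts G \<noteq> {}"
    and tm: "tree_metric (pverts G) \<delta>"
    and arcs: "parcs G = {(u, v). u \<in> pverts G \<and> v \<in> pverts G \<and> \<delta> u v = 1}"
  shows "undirected_tree G"
    and "u \<in> pverts G \<Longrightarrow> v \<in> pverts G \<Longrightarrow> tree_dist G u v = \<delta> u v"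
proof -
  interpret tree_metric "pverts G" \<delta> by (rule tm)
  interpret pair_graph G
  proof
    show "finite (parcs G)"
      by (rule finite_subset[of _ "pverts G \<times> pverts G"]) (auto simp: arcs finite_V)
    show "symmetric (with_proj G)" unfolding symmetric_def with_proj_simps arcs by (rule symI) (simp add: sym)
  qed (auto simp: arcs finite_V dest: zero_iff[THEN iffD2, rotated 2, OF refl])
  have path: "\<exists>p. apath u p v \<and> length p = \<delta> u v \<and> (\<forall>x\<in>set (awalk_verts u p). \<delta> x v \<le> \<delta> u v)"
    if "u \<in> pverts G" "v \<in> pverts G" for u v
    using that
  proof (induction "\<delta> u v" arbitrary: u)
    case 0
    then have "u = v" using zero_iff by auto
    then show ?case using 0 by (intro exI[of _ "[]"]) (auto simp: apath_Nil_iff)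
  next
    case (Suc n)
    then have "u \<noteq> v" using zero_iff[of u v] by auto
    then obtain w where w: "w \<in> pverts G" "\<delta> u w = 1" "\<delta> u v = \<delta> w v + 1"
      using ex1_closer[of u v] Suc by blast
    then obtain p where p: "apath w p v" "length p = \<delta> w v" "\<forall>x\<in>set (awalk_verts w p). \<delta> x v \<le> \<delta> w v"
      using Suc by fastforce
    have "u \<notin> set (awalk_verts w p)" using p(3) w(3) by auto
    then have "apath u ((u, w) # p) v" using p w Suc.prems by (simp add: apath_Cons_iff arcs)
    moreover have "\<forall>x\<in>set (awalk_verts u ((u, w) # p)). \<delta> x v \<le> \<delta> u v"
      using p(3) w(3) by auto
    ultimately show ?case using p(2) w(3) by (intro exI[of _ "(u, w) # p"]) simp
  qed
  have "strongly_connected (with_proj (mk_symmetric (with_proj G)))"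
  proof (rule strongly_connectedI)
    fix u v assume "u \<in> verts (with_proj (mk_symmetric (with_proj G)))"
      "v \<in> verts (with_proj (mk_symmetric (with_proj G)))"
    then have "u \<in> pverts G" "v \<in> pverts G" by simp_all
    then have "reachable (with_proj G) u v" using path reachable_apath by blast
    then show "reachable (with_proj (mk_symmetric (with_proj G))) u v"
      by (rule reachable_mk_symmetricI)
  qed (use ne in simp)
  then have conn: "connected (with_proj G)" by (simp add: connected_def)
  have acyclic: "\<not> (\<exists>p. cycle p \<and> 3 \<le> length p)"
  proof
    assume "\<exists>p. cycle p \<and> 3 \<le> length p"
    then obtain p u where p: "awalk u p u" "distinct (tl (awalk_verts u p))" and len: "3 \<le> length p"
      by (auto simp: cycle_def)
    define k where "k = length p"
    define c where "c i = awalk_verts u p ! i" for i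
    have lenv: "length (awalk_verts u p) = Suc k" by (simp add: k_def length_awalk_verts)
    have c0: "c 0 = u" "c k = u"
      using p(1) lenv by (auto simp: c_def awalk_conv hd_conv_nth last_conv_nth)
    have cV: "c i \<in> pverts G" if "i \<le> k" for i
    proof -
      have "c i \<in> set (awalk_verts u p)" using that lenv by (simp add: c_def)
      then show ?thesis using p(1) by blast
    qed
    have arc: "(c i, c (Suc i)) \<in> parcs G" if "i < k" for i
      using awalk_nth[OF p(1), of i] nth_mem[of i p] p(1) that by (auto simp: k_def c_def awalk_def)
    \<comment> \<open>Position 0 is excluded because \<open>c 0 = c k\<close>.\<close>
    have inj: "i = j" if "c i = c j" "1 \<le> i" "1 \<le> j" "i \<le> k" "j \<le> k" for i j
      using nth_eq_iff_index_eq[OF p(2), of "i - 1" "j - 1"] that lenv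
      by (auto simp: c_def nth_tl)
    have uV: "u \<in> pverts G" using cV[of 0] c0 by simp
    obtain m where m: "m \<le> k" and max: "\<And>i. i \<le> k \<Longrightarrow> \<delta> (c i) u \<le> \<delta> (c m) u"
    proof -
      let ?X = "(\<lambda>i. \<delta> (c i) u) ` {..k}"
      have "Max ?X \<in> ?X" by (rule Max_in) auto
      then obtain m where m: "Max ?X = \<delta> (c m) u" "m \<in> {..k}" by (rule imageE)
      show thesis
      proof (rule that[of m])
        show "m \<le> k" using m(2) by simp
        show "\<delta> (c i) u \<le> \<delta> (c m) u" if "i \<le> k" for i
          unfolding m(1)[symmetric] using that by (intro Max_ge) auto
      qed
    qed
    have "0 < k" using len k_def by linarith
    then have "(u, c 1) \<in> parcs G" using arc[of 0] c0 by simp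
    then have "c 1 \<noteq> u" using no_loops' by blast
    then have "0 < \<delta> (c m) u" using max[of 1] zero_iff[of "c 1" u] cV[of 1] uV len k_def by auto
    then have "c m \<noteq> u" using zero_iff[of u u] uV by auto
    then have "m \<noteq> 0" "m \<noteq> k" using c0 by metis+
    then have mk: "0 < m" "m < k" using m by auto
    have nb: "\<delta> (c m) (c j) = 1 \<and> \<delta> (c m) u = \<delta> (c j) u + 1" if "j = m - 1 \<or> j = Suc m" for j
    proof -
      have jk: "j \<le> k" using that mk by auto
      have "(c m, c j) \<in> parcs G"
        using that arc[of m] arc[of "m - 1"] arcs_symmetric mk by auto
      then have "\<delta> (c m) (c j) = 1" by (auto simp: arcs)
      then show ?thesis using adj[of "c m" u "c j"] max[OF jk] cV[OF m] cV[OF jk] uV by auto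
    qed
    have "c (m - 1) = c (Suc m)"
      using closer_unique[of "c m" u "c (m - 1)" "c (Suc m)"] nb[of "m - 1"] nb[of "Suc m"]
        cV[of m] cV[of "m - 1"] cV[of "Suc m"] uV mk by auto
    then show False
    proof (cases "m = 1")
      case True
      then have "c k = c 2" using \<open>c (m - 1) = c (Suc m)\<close> c0 by (simp add: numeral_2_eq_2)
      then show ?thesis using inj[of k 2] len k_def by simp
    next
      case False
      then have "1 \<le> m - 1" "m - 1 \<le> k" "Suc m \<le> k" using mk by linarith+
      then have "m - 1 = Suc m" using inj[OF \<open>c (m - 1) = c (Suc m)\<close>] by simp
      then show ?thesis by simp
    qed
  qed
  show "undirected_tree G" unfolding undirected_tree_def using pair_graph conn acyclic by blast
  show "tree_dist G u v = \<delta> u v" if "u \<in> pverts G" "v \<in> pverts G"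
    using path[OF that] tree_dist_eq[OF acyclic] by metis
qed

section \<open>Reciprocal sum of Laplacian eigenvalues\<close>

text \<open>
  The quadratic form $v^* A v$ is real and equals $e \, v^* v$.
\<close>

lemma symmetric_real_eigenvalue_real:
  fixes A :: "real mat"
  assumes A: "A \<in> carrier_mat n n"
    and sym: "\<And>i j. i < n \<Longrightarrow> j < n \<Longrightarrow> A $$ (i, j) = A $$ (j, i)"
    and ev: "eigenvalue (map_mat complex_of_real A) e"
  shows "e \<in> \<real>"
proof -
  let ?A = "map_mat complex_of_real A"
  from ev obtain v where v: "v \<in> carrier_vec n" "v \<noteq> 0\<^sub>v n" "?A *\<^sub>v v = e \<cdot>\<^sub>v v"
    using A by (auto simp: eigenvalue_def eigenvector_def)
  have Av: "(\<Sum>j<n. of_real (A $$ (i, j)) * v $ j) = e * v $ i" if "i < n" for i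
  proof -
    have "(?A *\<^sub>v v) $ i = (\<Sum>j<n. of_real (A $$ (i, j)) * v $ j)"
      using that A v(1) by (simp add: scalar_prod_def lessThan_atLeast0)
    then show ?thesis using that v by simp
  qed
  define q where "q = (\<Sum>i<n. \<Sum>j<n. cnj (v $ i) * of_real (A $$ (i, j)) * v $ j)"
  define s where "s = (\<Sum>i<n. (cmod (v $ i))\<^sup>2)"
  have "q = (\<Sum>i<n. cnj (v $ i) * (e * v $ i))"
    unfolding q_def by (intro sum.cong refl) (simp add: Av[symmetric] sum_distrib_left mult.assoc)
  also have "\<dots> = e * of_real s"
    unfolding s_def of_real_sum sum_distrib_left
    by (intro sum.cong refl) (simp only: complex_norm_square of_real_power[symmetric], simp add: complex_norm_square ac_simps)
  finally have q: "q = e * of_real s" .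
  have "cnj q = (\<Sum>i<n. \<Sum>j<n. cnj (v $ j) * of_real (A $$ (j, i)) * v $ i)"
    unfolding q_def by (auto simp: sym intro!: sum.cong)
  also have "\<dots> = q" unfolding q_def by (rule sum.swap)
  finally have "cnj q = q" .
  obtain i where "i < n" "v $ i \<noteq> 0" using v by (metis carrier_vecD eq_vecI index_zero_vec)
  then have "0 < s" unfolding s_def by (intro sum_pos2[of _ i]) auto
  then have "cnj e = e" using \<open>cnj q = q\<close> q by simp
  then show ?thesis by (simp add: Reals_cnj_iff)
qed

lemma symmetric_real_char_poly_splits:
  fixes A :: "real mat"
  assumes A: "A \<in> carrier_mat n n"
    and sym: "\<And>i j. i < n \<Longrightarrow> j < n \<Longrightarrow> A $$ (i, j) = A $$ (j, i)"
  shows "\<exists>es. char_poly A = (\<Prod>e\<leftarrow>es. [:- e, 1:])"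
proof -
  let ?A = "map_mat complex_of_real A"
  have A': "?A \<in> carrier_mat n n" using A by simp
  obtain as where as: "char_poly ?A = (\<Prod>a\<leftarrow>as. [:- a, 1:])"
    using char_poly_factorized[OF A'] by blast
  have real: "of_real (Re a) = a" if "a \<in> set as" for a
  proof -
    have "poly (char_poly ?A) a = 0"
      using that unfolding as by (auto simp: poly_prod_list prod_list_zero_iff)
    then have "eigenvalue ?A a" using eigenvalue_root_char_poly[OF A'] by simp
    then show ?thesis using symmetric_real_eigenvalue_real[OF A sym] by simp
  qed
  have "map_poly complex_of_real (char_poly A) = char_poly ?A"
    by (simp add: of_real_hom.char_poly_hom[OF A])
  also have "\<dots> = (\<Prod>a\<leftarrow>as. map_poly complex_of_real [:- Re a, 1:])"
    unfolding as using real by (intro arg_cong[of _ _ prod_list] map_cong refl) simp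
  also have "\<dots> = map_poly complex_of_real (\<Prod>e\<leftarrow>map Re as. [:- e, 1:])"
  proof -
    interpret map_poly_inj_idom_hom complex_of_real ..
    show ?thesis by (simp add: hom_prod_list o_def)
  qed
  finally have "char_poly A = (\<Prod>e\<leftarrow>map Re as. [:- e, 1:])"
  proof -
    interpret map_poly_inj_idom_hom complex_of_real ..
    assume "map_poly complex_of_real (char_poly A) = map_poly complex_of_real (\<Prod>e\<leftarrow>map Re as. [:- e, 1:])"
    then show ?thesis by (rule injectivity)
  qed
  then show ?thesis by blast
qed

text \<open>
  Column by column from the left: on and below the diagonal the entries of \<open>V * U\<close> reduce to the single
  product \<open>V $$ (i, j) * U $$ (j, j)\<close>.
\<close>

lemma upper_triangular_inverse_diagonal:
  fixes U V :: "'a :: field mat"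
  assumes U: "U \<in> carrier_mat n n" and V: "V \<in> carrier_mat n n"
    and tri: "upper_triangular U" and VU: "V * U = 1\<^sub>m n"
  shows "j < n \<Longrightarrow> (\<forall>i. j < i \<and> i < n \<longrightarrow> V $$ (i, j) = 0) \<and> V $$ (j, j) * U $$ (j, j) = 1"
proof (induction j rule: less_induct)
  case (less j)
  have entry: "(V * U) $$ (i, j) = V $$ (i, j) * U $$ (j, j)" if i: "i < n" "j \<le> i" for i
  proof -
    have "(V * U) $$ (i, j) = (\<Sum>k<n. V $$ (i, k) * U $$ (k, j))"
      using i less.prems U V by (simp add: scalar_prod_def lessThan_atLeast0)
    also have "\<dots> = (\<Sum>k<n. if k = j then V $$ (i, j) * U $$ (j, j) else 0)"
    proof (rule sum.cong)
      fix k assume k: "k \<in> {..<n}"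
      consider "k < j" | "k = j" | "j < k" by linarith
      then show "V $$ (i, k) * U $$ (k, j) = (if k = j then V $$ (i, j) * U $$ (j, j) else 0)"
      proof cases
        case 1
        then have "V $$ (i, k) = 0" using less.IH[of k] less.prems i by auto
        then show ?thesis using 1 by simp
      next
        case 3
        then have "U $$ (k, j) = 0" using tri k U by (auto simp: upper_triangular_def)
        then show ?thesis using 3 by simp
      qed simp
    qed simp
    also have "\<dots> = V $$ (i, j) * U $$ (j, j)" using less.prems by simp
    finally show ?thesis .
  qed
  have diag: "V $$ (j, j) * U $$ (j, j) = 1" using entry[of j] less.prems VU by simp
  moreover have "V $$ (i, j) = 0" if "j < i" "i < n" for i
  proof -
    have "V $$ (i, j) * U $$ (j, j) = 0" using entry[of i] that less.prems VU by simp
    then show ?thesis using diag by auto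
  qed
  ultimately show ?case by blast
qed

lemma trace_conjugate:
  fixes X :: "'a :: comm_ring_1 mat"
  assumes X: "X \<in> carrier_mat n n" and P: "P \<in> carrier_mat n n" and Q: "Q \<in> carrier_mat n n"
    and PQ: "P * Q = 1\<^sub>m n"
  shows "(\<Sum>i<n. (Q * X * P) $$ (i, i)) = (\<Sum>i<n. X $$ (i, i))"
proof -
  have sw: "(\<Sum>i<n. (C * D) $$ (i, i)) = (\<Sum>i<n. (D * C) $$ (i, i))"
    if C: "C \<in> carrier_mat n n" and D: "D \<in> carrier_mat n n" for C D :: "'a mat"
  proof -
    have "(\<Sum>i<n. (C * D) $$ (i, i)) = (\<Sum>i<n. \<Sum>j<n. C $$ (i, j) * D $$ (j, i))"
      using C D by (intro sum.cong) (simp_all add: scalar_prod_def lessThan_atLeast0)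
    also have "\<dots> = (\<Sum>j<n. \<Sum>i<n. D $$ (j, i) * C $$ (i, j))"
      by (subst sum.swap) (simp add: mult.commute)
    also have "\<dots> = (\<Sum>i<n. (D * C) $$ (i, i))"
      using C D by (intro sum.cong) (simp_all add: scalar_prod_def lessThan_atLeast0)
    finally show ?thesis .
  qed
  have "P * (Q * X) = X" using X P Q PQ by (simp add: assoc_mult_mat[symmetric])
  then show ?thesis using sw[of "Q * X" P] X P Q by simp
qed


text \<open>
  Stated for any symmetric matrix with vanishing row sums that admits a matrix \<open>D\<close> satisfying the
  identity between Laplacian and distance matrix of a tree.  This identity forces the kernel
  of \<open>L\<close> to consist of constant vectors, and the invertibility of \<open>L + K\<close> shows that the eigenvalue 0 is
  simple.
\<close>

lemma sum_inverse_eigenvalues: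
  fixes L :: "real mat" and D :: "nat \<Rightarrow> nat \<Rightarrow> real"
  assumes n: "0 < n" and L: "L \<in> carrier_mat n n"
    and symL: "\<And>i j. i < n \<Longrightarrow> j < n \<Longrightarrow> L $$ (i, j) = L $$ (j, i)"
    and row: "\<And>i. i < n \<Longrightarrow> (\<Sum>j<n. L $$ (i, j)) = 0"
    and symD: "\<And>i j. i < n \<Longrightarrow> j < n \<Longrightarrow> D i j = D j i"
    and diagD: "\<And>i. i < n \<Longrightarrow> D i i = 0"
    and LD: "\<And>i j. i < n \<Longrightarrow> j < n \<Longrightarrow> (\<Sum>k<n. L $$ (i, k) * D k j) = \<tau> i - (if i = j then 2 else 0)"
  shows "\<exists>es. char_poly L = (\<Prod>e\<leftarrow>0 # es. [:- e, 1:]) \<and> 0 \<notin> set es \<and> Suc (length es) = n \<and>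
    (\<Sum>e\<leftarrow>es. 1 / e) = (\<Sum>i<n. \<Sum>j<n. D i j) / (2 * real n)"
proof -
  have idx: "(X * Y) $$ (i, j) = (\<Sum>k<n. X $$ (i, k) * Y $$ (k, j))"
    if "X \<in> carrier_mat n n" "Y \<in> carrier_mat n n" "i < n" "j < n" for X Y :: "real mat" and i j
    using that by (simp add: scalar_prod_def lessThan_atLeast0)
  have col: "(\<Sum>i<n. L $$ (i, j)) = 0" if "j < n" for j
  proof -
    have "(\<Sum>i<n. L $$ (i, j)) = (\<Sum>i<n. L $$ (j, i))" using that symL by (intro sum.cong) auto
    then show ?thesis using row[OF that] by simp
  qed

  obtain es0 where es0: "char_poly L = (\<Prod>e\<leftarrow>es0. [:- e, 1:])"
    using symmetric_real_char_poly_splits[OF L symL] by blast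
  have "eigenvalue L 0"
    unfolding eigenvalue_def eigenvector_def
  proof (intro exI conjI)
    let ?one = "vec n (\<lambda>_. 1) :: real vec"
    show "?one \<in> carrier_vec (dim_row L)" using L by simp
    show "?one \<noteq> 0\<^sub>v (dim_row L)"
    proof
      assume "?one = 0\<^sub>v (dim_row L)"
      then have "?one $ 0 = 0\<^sub>v n $ 0" using L by simp
      then show False using n by simp
    qed
    show "L *\<^sub>v ?one = 0 \<cdot>\<^sub>v ?one"
      using L row by (intro eq_vecI) (simp_all add: scalar_prod_def lessThan_atLeast0)
  qed
  then have "0 \<in> set es0"
    unfolding eigenvalue_root_char_poly[OF L] es0 by (auto simp: poly_prod_list prod_list_zero_iff)
  define es where "es = remove1 0 es0"
  have cp: "char_poly L = (\<Prod>e\<leftarrow>0 # es. [:- e, 1:])"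
    unfolding es0 es_def using prod_list_map_remove1[OF \<open>0 \<in> set es0\<close>, of "\<lambda>e. [:- e, 1:]"] by simp

  obtain B P Q where "schur_decomposition L (0 # es) = (B, P, Q)" using prod_cases3 by blast
  from schur_decomposition[OF L cp this]
  have wit: "similar_mat_wit L B P Q" and tri: "upper_triangular B" and diag: "diag_mat B = 0 # es"
    by auto
  from similar_mat_witD2[OF L wit]
  have PQ: "P * Q = 1\<^sub>m n" and QP: "Q * P = 1\<^sub>m n" and LPBQ: "L = P * B * Q"
    and B: "B \<in> carrier_mat n n" and P: "P \<in> carrier_mat n n" and Q: "Q \<in> carrier_mat n n" by auto
  have len: "Suc (length es) = n" using arg_cong[OF diag, of length] B by (simp add: diag_mat_def)
  have B00: "B $$ (0, 0) = 0" and Bii: "\<And>i. Suc i < n \<Longrightarrow> B $$ (Suc i, Suc i) = es ! i"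
  proof -
    have *: "B $$ (i, i) = (0 # es) ! i" if "i < n" for i
      unfolding diag[symmetric] using that B by (simp add: diag_mat_def)
    show "B $$ (0, 0) = 0" using *[OF n] by simp
    show "\<And>i. Suc i < n \<Longrightarrow> B $$ (Suc i, Suc i) = es ! i" using * by simp
  qed
  have Blow: "B $$ (i, j) = 0" if "j < i" "i < n" for i j
    using tri that B by (auto simp: upper_triangular_def)
  have LP: "L * P = P * B"
    unfolding LPBQ using P B Q QP by (simp add: assoc_mult_mat[of _ n n _ n _ n])
  have QLP: "Q * L * P = B"
    using LP QP P B Q L by (simp add: assoc_mult_mat[of _ n n _ n _ n]) (simp add: assoc_mult_mat[of _ n n _ n _ n, symmetric])

  \<comment> \<open>The first column of \<open>P\<close> lies in the kernel of \<open>L\<close>; multiplying by \<open>D\<close> shows that it is constant.\<close>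
  define c where "c = (\<Sum>k<n. \<tau> k * P $$ (k, 0)) / 2"
  have Lp: "(\<Sum>k<n. L $$ (i, k) * P $$ (k, 0)) = 0" if i: "i < n" for i
  proof -
    have "(\<Sum>k<n. L $$ (i, k) * P $$ (k, 0)) = (\<Sum>k<n. P $$ (i, k) * B $$ (k, 0))"
      using idx[OF L P i n] idx[OF P B i n] LP by simp
    also have "\<dots> = 0" using B00 Blow by (intro sum.neutral) (metis lessThan_iff mult_zero_right neq0_conv)
    finally show ?thesis .
  qed
  have Pc: "P $$ (j, 0) = c" if j: "j < n" for j
  proof -
    have "0 = (\<Sum>i<n. D i j * (\<Sum>k<n. L $$ (i, k) * P $$ (k, 0)))" using Lp by simp
    also have "\<dots> = (\<Sum>k<n. (\<Sum>i<n. L $$ (k, i) * D i j) * P $$ (k, 0))"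
      unfolding sum_distrib_left sum_distrib_right
      by (subst sum.swap) (auto simp: symL ac_simps intro!: sum.cong)
    also have "\<dots> = (\<Sum>k<n. \<tau> k * P $$ (k, 0) - (if k = j then 2 * P $$ (k, 0) else 0))"
      using LD j by (intro sum.cong) (auto simp: left_diff_distrib)
    also have "\<dots> = 2 * c - 2 * P $$ (j, 0)" using j by (simp add: sum_subtractf c_def)
    finally show ?thesis by simp
  qed
  have cQ: "c * (\<Sum>k<n. Q $$ (i, k)) = (if i = 0 then 1 else 0)" if i: "i < n" for i
  proof -
    have "(Q * P) $$ (i, 0) = (\<Sum>k<n. Q $$ (i, k) * c)" unfolding idx[OF Q P i n] using Pc by simp
    then show ?thesis unfolding QP using i n by (simp add: sum_distrib_left mult.commute)
  qed
  have c0: "c \<noteq> 0" using cQ[OF n] by auto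

  \<comment> \<open>Adding the projection \<open>K\<close> onto the constants changes only the first row of the triangular form.\<close>
  define K where "K = mat n n (\<lambda>_. 1 / real n)"
  have K: "K \<in> carrier_mat n n" by (simp add: K_def)
  define A where "A = L + K"
  have A: "A \<in> carrier_mat n n" using L K by (simp add: A_def)
  define U where "U = Q * A * P"
  have U: "U \<in> carrier_mat n n" using Q A P by (simp add: U_def)
  have KP: "(K * P) $$ (i, j) = (\<Sum>k<n. P $$ (k, j)) / real n" if "i < n" "j < n" for i j
    unfolding idx[OF K P that] using that by (simp add: K_def sum_divide_distrib)
  have U_entry: "U $$ (i, j) = B $$ (i, j) + (if i = 0 then (\<Sum>k<n. P $$ (k, j)) / real n / c else 0)"
    if i: "i < n" and j: "j < n" for i j
  proof -
    have "U = B + Q * (K * P)"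
      unfolding QLP[symmetric] U_def
      unfolding A_def using Q L K P by (simp add: mult_add_distrib_mat[of _ n n _ n] add_mult_distrib_mat[of _ n n _ _ n] assoc_mult_mat[of _ n n _ n _ n])
    moreover have "(Q * (K * P)) $$ (i, j) = (\<Sum>k<n. Q $$ (i, k)) * ((\<Sum>k<n. P $$ (k, j)) / real n)"
      using KP[OF _ j] unfolding idx[OF Q mult_carrier_mat[OF K P] i j] sum_distrib_right by (intro sum.cong) auto
    moreover have "(\<Sum>k<n. Q $$ (i, k)) = (if i = 0 then 1 / c else 0)"
      using cQ[OF i] c0 by (simp add: field_simps split: if_splits)
    moreover have "(B + Q * (K * P)) $$ (i, j) = B $$ (i, j) + (Q * (K * P)) $$ (i, j)"
      using Q P i j by (intro index_add_mat) auto
    ultimately show ?thesis using c0 by simp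
  qed
  have triU: "upper_triangular U" using U_entry Blow U by (auto simp: upper_triangular_def)
  have "(\<Sum>k<n. P $$ (k, 0)) / real n / c = 1" using Pc c0 n by simp
  then have U00: "U $$ (0, 0) = 1" using U_entry[OF n n] B00 by (simp only: refl if_True add_0_left)
  have Uii: "U $$ (Suc i, Suc i) = es ! i" if "Suc i < n" for i
    using U_entry[of "Suc i" "Suc i"] Bii that by simp

  \<comment> \<open>\<open>M\<close> is \<open>K\<close> minus half of \<open>D\<close> compressed to the complement of the constants.\<close>
  define r where "r i = (\<Sum>j<n. D i j)" for i
  define S where "S = (\<Sum>i<n. r i)"
  define M where "M = mat n n (\<lambda>(i, j). - (D i j - r i / n - r j / n + S / n\<^sup>2) / 2 + 1 / n)"
  have M: "M \<in> carrier_mat n n" by (simp add: M_def)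
  have Lr: "(\<Sum>k<n. L $$ (i, k) * r k) = n * \<tau> i - 2" if "i < n" for i
  proof -
    have "(\<Sum>k<n. L $$ (i, k) * r k) = (\<Sum>j<n. \<Sum>k<n. L $$ (i, k) * D k j)"
      unfolding r_def sum_distrib_left by (rule sum.swap)
    also have "\<dots> = (\<Sum>j<n. \<tau> i - (if i = j then 2 else 0))" using LD that by (intro sum.cong) auto
    finally show ?thesis using that by (simp add: sum_subtractf)
  qed
  have colM: "(\<Sum>k<n. M $$ (k, j)) = 1" if j: "j < n" for j
  proof -
    have "(\<Sum>k<n. D k j) = r j" unfolding r_def using symD j by (intro sum.cong) auto
    then have "(\<Sum>k<n. M $$ (k, j)) = - (r j - S / n - n * (r j / n) + n * (S / n\<^sup>2)) / 2 + 1"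
      using j n by (simp add: M_def sum.distrib sum_subtractf sum_negf sum_divide_distrib[symmetric] S_def)
    then show ?thesis using n by (simp add: power2_eq_square)
  qed
  have LM: "(\<Sum>k<n. L $$ (i, k) * M $$ (k, j)) = (if i = j then 1 else 0) - 1 / n" if i: "i < n" and j: "j < n" for i j
  proof -
    have "(\<Sum>k<n. L $$ (i, k) * M $$ (k, j)) =
        (\<Sum>k<n. (- 1 / 2) * (L $$ (i, k) * D k j) + (1 / (2 * n)) * (L $$ (i, k) * r k)
          + (r j / (2 * n) - S / (2 * n\<^sup>2) + 1 / n) * L $$ (i, k))"
      using i j by (intro sum.cong) (simp_all add: M_def field_simps)
    also have "\<dots> = (- 1 / 2) * (\<tau> i - (if i = j then 2 else 0)) + (1 / (2 * n)) * (n * \<tau> i - 2)"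
      unfolding sum.distrib sum_distrib_left[symmetric] LD[OF i j] Lr[OF i] row[OF i] by simp
    also have "\<dots> = (if i = j then 1 else 0) - 1 / n" using n by (simp add: field_simps)
    finally show ?thesis .
  qed
  have AM: "A * M = 1\<^sub>m n"
  proof (rule eq_matI)
    fix i j assume "i < dim_row (1\<^sub>m n :: real mat)" "j < dim_col (1\<^sub>m n :: real mat)"
    then have i: "i < n" and j: "j < n" by auto
    have "(A * M) $$ (i, j) = (\<Sum>k<n. L $$ (i, k) * M $$ (k, j) + M $$ (k, j) / n)"
      unfolding idx[OF A M i j] using i L by (intro sum.cong) (auto simp: A_def K_def algebra_simps)
    also have "\<dots> = (if i = j then 1 else 0)"
      using LM[OF i j] colM[OF j] by (simp add: sum.distrib sum_divide_distrib[symmetric])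
    finally show "(A * M) $$ (i, j) = 1\<^sub>m n $$ (i, j)" using i j by simp
  qed (use A M in auto)
  have MA: "M * A = 1\<^sub>m n" by (rule mat_mult_left_right_inverse[OF A M AM])

  define V where "V = Q * M * P"
  have V: "V \<in> carrier_mat n n" using Q M P by (simp add: V_def)
  have "V * U = Q * M * (P * Q) * A * P"
    unfolding V_def U_def using Q M P A by (simp add: assoc_mult_mat[of _ n n _ n _ n])
  also have "\<dots> = Q * (M * A) * P"
    unfolding PQ using Q M P A by (simp add: assoc_mult_mat[of _ n n _ n _ n])
  also have "\<dots> = 1\<^sub>m n" unfolding MA using Q P QP by simp
  finally have VU: "V * U = 1\<^sub>m n" .
  have inv: "V $$ (j, j) * U $$ (j, j) = 1" if "j < n" for j
    using upper_triangular_inverse_diagonal[OF U V triU VU that] by blast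

  have es0': "es ! i \<noteq> 0" if "i < length es" for i
    using inv[of "Suc i"] Uii[of i] len that by auto
  have "(\<Sum>i<n. V $$ (i, i)) = V $$ (0, 0) + (\<Sum>i<length es. V $$ (Suc i, Suc i))"
    unfolding len[symmetric] by (rule sum.lessThan_Suc_shift)
  also have "V $$ (0, 0) = 1" using inv[OF n] U00 by simp
  also have "(\<Sum>i<length es. V $$ (Suc i, Suc i)) = (\<Sum>i<length es. 1 / es ! i)"
  proof (rule sum.cong)
    fix i assume "i \<in> {..<length es}"
    then have "V $$ (Suc i, Suc i) * es ! i = 1" using inv[of "Suc i"] Uii[of i] len by auto
    then show "V $$ (Suc i, Suc i) = 1 / es ! i" by (simp add: eq_divide_eq) auto
  qed simp
  also have "(\<Sum>i<length es. 1 / es ! i) = (\<Sum>e\<leftarrow>es. 1 / e)"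
    by (simp add: sum_list_sum_nth lessThan_atLeast0)
  finally have trV: "(\<Sum>i<n. V $$ (i, i)) = 1 + (\<Sum>e\<leftarrow>es. 1 / e)" .
  have "(\<Sum>i<n. M $$ (i, i)) = (\<Sum>i<n. r i / n - S / (2 * n\<^sup>2) + 1 / n)"
    using diagD by (intro sum.cong) (auto simp: M_def field_simps)
  also have "\<dots> = S / n - n * (S / (2 * n\<^sup>2)) + 1"
    using n by (simp add: sum.distrib sum_subtractf sum_divide_distrib[symmetric] S_def)
  also have "\<dots> = 1 + S / (2 * n)" using n by (simp add: field_simps power2_eq_square)
  finally have "(\<Sum>e\<leftarrow>es. 1 / e) = S / (2 * n)"
    using trV trace_conjugate[OF M P Q PQ] by (simp add: V_def)
  moreover have "0 \<notin> set es" using es0' by (metis in_set_conv_nth)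
  ultimately show ?thesis
    by (intro exI[of _ es] conjI) (use cp len in \<open>simp_all add: S_def r_def\<close>)
qed

text \<open>
  Twice the quadratic form of \<open>L\<close> at \<open>x\<close> is the sum of $-L_{ij} (x_i - x_j)^2$, because rows and columns
  sum to zero.
\<close>

lemma laplacian_like_eigenvalue_nonneg:
  fixes L :: "real mat"
  assumes L: "L \<in> carrier_mat n n"
    and symL: "\<And>i j. i < n \<Longrightarrow> j < n \<Longrightarrow> L $$ (i, j) = L $$ (j, i)"
    and row: "\<And>i. i < n \<Longrightarrow> (\<Sum>j<n. L $$ (i, j)) = 0"
    and off_diag: "\<And>i j. i < n \<Longrightarrow> j < n \<Longrightarrow> i \<noteq> j \<Longrightarrow> L $$ (i, j) \<le> 0"
    and ev: "eigenvalue L e"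
  shows "0 \<le> e"
proof -
  from ev obtain v where v: "v \<in> carrier_vec n" "v \<noteq> 0\<^sub>v n" "L *\<^sub>v v = e \<cdot>\<^sub>v v"
    using L by (auto simp: eigenvalue_def eigenvector_def)
  define x where "x i = v $ i" for i
  have Lx: "(\<Sum>j<n. L $$ (i, j) * x j) = e * x i" if "i < n" for i
  proof -
    have "(L *\<^sub>v v) $ i = (\<Sum>j<n. L $$ (i, j) * x j)"
      using that L v(1) by (simp add: scalar_prod_def lessThan_atLeast0 x_def)
    then show ?thesis using that v by (simp add: x_def)
  qed
  have "(\<Sum>i<n. \<Sum>j<n. L $$ (i, j) * (x i - x j)\<^sup>2)
    = (\<Sum>i<n. \<Sum>j<n. (x i)\<^sup>2 * L $$ (i, j)) + (\<Sum>i<n. \<Sum>j<n. (x j)\<^sup>2 * L $$ (j, i))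
      - 2 * (\<Sum>i<n. \<Sum>j<n. x i * (L $$ (i, j) * x j))"
    unfolding sum_distrib_left sum.distrib[symmetric] sum_subtractf[symmetric]
    by (intro sum.cong refl) (auto simp: symL power2_eq_square algebra_simps)
  moreover have "(\<Sum>i<n. \<Sum>j<n. (x i)\<^sup>2 * L $$ (i, j)) = 0"
    using row by (simp add: sum_distrib_left[symmetric])
  moreover from this have "(\<Sum>i<n. \<Sum>j<n. (x j)\<^sup>2 * L $$ (j, i)) = 0"
    by (subst sum.swap)
  moreover have "(\<Sum>i<n. \<Sum>j<n. x i * (L $$ (i, j) * x j)) = e * (\<Sum>i<n. (x i)\<^sup>2)"
    unfolding sum_distrib_left[symmetric] using Lx
    by (simp add: sum_distrib_left power2_eq_square ac_simps)
  ultimately have eq: "(\<Sum>i<n. \<Sum>j<n. L $$ (i, j) * (x i - x j)\<^sup>2) = - 2 * (e * (\<Sum>i<n. (x i)\<^sup>2))"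
    by simp
  have term_le: "L $$ (i, j) * (x i - x j)\<^sup>2 \<le> 0" if "i < n" "j < n" for i j
    using off_diag[OF that] by (cases "i = j") (auto intro: mult_nonpos_nonneg)
  have "(\<Sum>i<n. \<Sum>j<n. L $$ (i, j) * (x i - x j)\<^sup>2) \<le> 0"
    using term_le by (intro sum_nonpos) auto
  then have "0 \<le> e * (\<Sum>i<n. (x i)\<^sup>2)" using eq by linarith
  moreover obtain i where "i < n" "v $ i \<noteq> 0" using v by (metis carrier_vecD eq_vecI index_zero_vec)
  then have "0 < (\<Sum>i<n. (x i)\<^sup>2)" by (intro sum_pos2[of _ i]) (auto simp: x_def)
  ultimately show ?thesis by (simp add: zero_le_mult_iff)
qed

text \<open>
  Exactly one neighbour of \<open>u\<close> has distance \<open>\<delta> u v - 1\<close> if \<open>u \<noteq> v\<close>, and all others have distance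
  \<open>\<delta> u v + 1\<close>.  This is the identity between Laplacian and distance matrix.
\<close>

lemma (in tree_metric) sum_neighbour_distances:
  assumes u: "u \<in> V" and v: "v \<in> V"
  shows "(\<Sum>w\<in>{w \<in> V. \<delta> u w = 1}. real (\<delta> w v))
    = real (card {w \<in> V. \<delta> u w = 1}) * (real (\<delta> u v) + 1) - (if u = v then 0 else 2)"
proof (cases "u = v")
  case True
  have "(\<Sum>w\<in>{w \<in> V. \<delta> u w = 1}. real (\<delta> w v)) = (\<Sum>w\<in>{w \<in> V. \<delta> u w = 1}. 1)"
    using sym u True by (intro sum.cong) auto
  then show ?thesis using True u zero_iff[of u u] by simp
next
  case False
  let ?N = "{w \<in> V. \<delta> u w = 1}"
  obtain w where w: "w \<in> V" "\<delta> u w = 1" "\<delta> u v = \<delta> w v + 1"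
    using ex1_closer[OF u v False] by blast
  have "real (\<delta> z v) = (real (\<delta> u v) + 1) - (if z = w then 2 else 0)" if "z \<in> ?N" for z
    using adj[of u v z] closer_unique[of u v w z] that w u v by auto
  then have "(\<Sum>z\<in>?N. real (\<delta> z v)) = (\<Sum>z\<in>?N. (real (\<delta> u v) + 1) - (if z = w then 2 else 0))"
    by (intro sum.cong) auto
  also have "\<dots> = real (card ?N) * (real (\<delta> u v) + 1) - 2"
    using finite_V w by (simp add: sum_subtractf)
  finally show ?thesis using False by simp
qed

text \<open>
  The total distance counts ordered pairs, and each eigenvalue enters the norm with the factor
  $1/2$, hence the denominator $4N$.  Nonnegativity of the eigenvalues is what puts 0 in front of the
  sorted spectrum.
\<close>

lemma h2_norm_eq_total_distance:
  fixes G :: "'a pair_pre_digraph"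
  assumes tm: "tree_metric (pverts G) \<delta>"
    and V: "pverts G \<noteq> {}"
    and arcs: "parcs G = {(u, v). u \<in> pverts G \<and> v \<in> pverts G \<and> \<delta> u v = 1}"
  shows "h2_norm G = sqrt (real (tree_metric.total_distance (pverts G) \<delta>) / (4 * real (card (pverts G))))"
proof -
  interpret tree_metric "pverts G" \<delta> by (rule tm)
  define vs where "vs = (SOME vs. distinct vs \<and> set vs = pverts G)"
  have "\<exists>vs. distinct vs \<and> set vs = pverts G" using finite_distinct_list[OF finite_V] by blast
  then have vs: "distinct vs" "set vs = pverts G" unfolding vs_def by (metis (mono_tags, lifting) someI_ex)+
  define n where "n = length vs"
  have n: "n = card (pverts G)" using distinct_card[OF vs(1)] vs(2) n_def by simp
  have n0: "0 < n" using n V finite_V by (simp add: card_gt_0_iff)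
  have vsV: "vs ! i \<in> pverts G" if "i < n" for i using that vs n_def nth_mem by blast
  have vs_eq: "vs ! i = vs ! j \<longleftrightarrow> i = j" if "i < n" "j < n" for i j
    using that vs n_def nth_eq_iff_index_eq by blast
  have reindex: "(\<Sum>j<n. h (vs ! j)) = (\<Sum>v\<in>pverts G. h v)" for h :: "'a \<Rightarrow> real"
    using sum.reindex_bij_betw[OF bij_betw_nth[OF vs(1), of "{..<n}" "pverts G"]] vs n_def by auto
  define N where "N u = {w \<in> pverts G. \<delta> u w = 1}" for u
  have deg: "out_degree (with_proj G) u = card (N u)" if "u \<in> pverts G" for u
  proof -
    have "out_arcs (with_proj G) u = Pair u ` N u"
      using that by (auto simp: out_arcs_def N_def arcs)
    then show ?thesis by (simp add: out_degree_def card_image inj_on_def)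
  qed
  define L where "L = laplacian_mat vs G"
  have L: "L \<in> carrier_mat n n" using laplacian_mat_carrier by (simp add: L_def n_def)
  define l where "l u v = (if u = v then real (card (N u)) else 0) - (if v \<in> N u then 1 else 0)" for u v
  have Lij: "L $$ (i, j) = l (vs ! i) (vs ! j)" if "i < n" "j < n" for i j
    using that laplacian_mat_index[of i vs j G] deg[of "vs ! i"] vsV vs_eq
    by (auto simp: L_def n_def l_def N_def arcs)
  have l_sum: "(\<Sum>v\<in>pverts G. l u v * h v) = real (card (N u)) * h u - (\<Sum>v\<in>N u. h v)"
    if "u \<in> pverts G" for u and h :: "'a \<Rightarrow> real"
  proof -
    have "(\<Sum>v\<in>pverts G. l u v * h v) = (\<Sum>v\<in>pverts G. (if u = v then real (card (N u)) * h u else 0))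
      - (\<Sum>v\<in>pverts G. if v \<in> N u then h v else 0)"
      unfolding sum_subtractf[symmetric] by (intro sum.cong) (auto simp: l_def algebra_simps)
    also have "(\<Sum>v\<in>pverts G. if v \<in> N u then h v else 0) = (\<Sum>v\<in>N u. h v)"
      using finite_V by (subst sum.inter_restrict[symmetric]) (auto simp: N_def Int_def intro!: sum.cong)
    finally show ?thesis using that finite_V by simp
  qed
  have symL: "L $$ (i, j) = L $$ (j, i)" if "i < n" "j < n" for i j
    using Lij that vsV sym[of "vs ! i" "vs ! j"] by (simp add: l_def N_def)
  have row: "(\<Sum>j<n. L $$ (i, j)) = 0" if i: "i < n" for i
  proof -
    have "(\<Sum>j<n. L $$ (i, j)) = (\<Sum>v\<in>pverts G. l (vs ! i) v * 1)"
      using Lij[OF i] by (simp add: reindex)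
    then show ?thesis using l_sum[OF vsV[OF i], of "\<lambda>_. 1"] by simp
  qed
  define D where "D i j = real (\<delta> (vs ! i) (vs ! j))" for i j
  have LD: "(\<Sum>k<n. L $$ (i, k) * D k j) = (2 - real (card (N (vs ! i)))) - (if i = j then 2 else 0)"
    if i: "i < n" and j: "j < n" for i j
  proof -
    have "(\<Sum>k<n. L $$ (i, k) * D k j) = (\<Sum>v\<in>pverts G. l (vs ! i) v * real (\<delta> v (vs ! j)))"
      using Lij[OF i] reindex[of "\<lambda>v. l (vs ! i) v * real (\<delta> v (vs ! j))"] by (simp add: D_def)
    then show ?thesis
      unfolding l_sum[OF vsV[OF i]]
      using sum_neighbour_distances[OF vsV[OF i] vsV[OF j], folded N_def] vs_eq[OF i j]
      by (auto simp: algebra_simps)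
  qed
  have "\<exists>es. char_poly L = (\<Prod>e\<leftarrow>0 # es. [:- e, 1:]) \<and> 0 \<notin> set es \<and> Suc (length es) = n \<and>
    (\<Sum>e\<leftarrow>es. 1 / e) = (\<Sum>i<n. \<Sum>j<n. D i j) / (2 * real n)"
    by (rule sum_inverse_eigenvalues[OF n0 L symL row _ _ LD])
      (use vsV sym zero_iff in \<open>auto simp: D_def\<close>)
  then obtain es where cp: "char_poly L = (\<Prod>e\<leftarrow>0 # es. [:- e, 1:])" and len: "Suc (length es) = n"
    and tr: "(\<Sum>e\<leftarrow>es. 1 / e) = (\<Sum>i<n. \<Sum>j<n. D i j) / (2 * real n)" by blast
  have nonneg: "0 \<le> e" if "e \<in> set es" for e
  proof (rule laplacian_like_eigenvalue_nonneg[OF L symL row])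
    show "eigenvalue L e"
      unfolding eigenvalue_root_char_poly[OF L] cp using that
      by (auto simp: poly_prod_list prod_list_zero_iff)
    show "L $$ (i, j) \<le> 0" if "i < n" "j < n" "i \<noteq> j" for i j
      using Lij[OF that(1,2)] vs_eq[OF that(1,2)] that(3) by (simp add: l_def)
  qed
  have "proots (char_poly L) = mset (0 # es)"
  proof -
    have "proots (\<Prod>e\<leftarrow>xs. [:- e, 1:]) = mset xs" for xs :: "real list"
    proof (induction xs)
      case (Cons a xs)
      have "(\<Prod>e\<leftarrow>xs. [:- e, 1:]) \<noteq> 0" by (auto simp: prod_list_zero_iff)
      then show ?case using Cons by (simp only: list.map prod_list.Cons) (subst proots_mult, simp_all)
    qed simp
    then show ?thesis unfolding cp .
  qed
  then have spec: "laplacian_spectrum G = 0 # sort es"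
    unfolding laplacian_spectrum_def vs_def[symmetric] L_def[symmetric]
    using nonneg by (simp only: sorted_list_of_multiset_mset) (simp add: insort_is_Cons)
  have "(\<Sum>i = 1..<card (pverts G). 1 / (2 * laplacian_spectrum G ! i)) = (\<Sum>i<length es. 1 / (2 * sort es ! i))"
    unfolding spec n[symmetric] len[symmetric] lessThan_atLeast0
    by (subst One_nat_def, subst sum.shift_bounds_Suc_ivl) simp
  also have "\<dots> = (\<Sum>e\<leftarrow>sort es. 1 / e) / 2"
    by (simp add: sum_list_sum_nth lessThan_atLeast0 sum_divide_distrib mult.commute)
  also have "(\<Sum>e\<leftarrow>sort es. 1 / e) = (\<Sum>e\<leftarrow>es. 1 / e)"
    by (metis mset_map mset_sort sum_mset_sum_list)
  finally have "(\<Sum>i = 1..<card (pverts G). 1 / (2 * laplacian_spectrum G ! i)) = (\<Sum>e\<leftarrow>es. 1 / e) / 2" .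
  moreover have "(\<Sum>i<n. \<Sum>j<n. D i j) = real total_distance"
    unfolding total_distance_def of_nat_sum
    by (simp add: D_def reindex[of "\<lambda>v. real (\<delta> _ v)"] reindex[of "\<lambda>u. \<Sum>v\<in>pverts G. real (\<delta> u v)"])
  ultimately show ?thesis unfolding h2_norm_def tr n by simp
qed

section \<open>The extremal tree\<close>

text \<open>
  The node of the path below a given node: a leaf beyond \<open>d\<close> sits on node \<open>m\<close>.
\<close>

definition P_position :: "nat \<Rightarrow> nat \<Rightarrow> nat \<Rightarrow> nat" where
  "P_position d m v = (if v \<le> d then v else m)"

definition P_dist :: "nat \<Rightarrow> nat \<Rightarrow> nat \<Rightarrow> nat \<Rightarrow> nat" where
  "P_dist d m u v = (if u = v then 0 else
     absdiff (P_position d m u) (P_position d m v) + of_bool (d < u) + of_bool (d < v))"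

lemma P_dist_eq_1_iff:
  assumes "m \<le> d"
  shows "P_dist d m u v = 1 \<longleftrightarrow>
    u \<le> d \<and> v \<le> d \<and> (v = Suc u \<or> u = Suc v) \<or> u = m \<and> d < v \<or> d < u \<and> v = m"
  using assms by (auto simp: P_dist_def P_position_def absdiff_def)

lemma tree_metric_P_dist:
  assumes m: "m \<le> d" and N: "d < N"
  shows "tree_metric {0..<N} (P_dist d m)"
proof
  fix u v :: nat
  show "P_dist d m u v = 0 \<longleftrightarrow> u = v"
    by (auto simp: P_dist_def P_position_def absdiff_def split: if_splits)
  show "P_dist d m u v = P_dist d m v u"
    by (auto simp: P_dist_def absdiff_def)
  assume uN: "u \<in> {0..<N}" and vN: "v \<in> {0..<N}" and uv: "u \<noteq> v"
  \<comment> \<open>The neighbour of \<open>u\<close> on the way to \<open>v\<close>: down from a leaf, up to a leaf, or along the path.\<close>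
  define w where "w = (if d < u then m else if d < v \<and> u = m then v
    else if u < P_position d m v then Suc u else u - 1)"
  have pos: "P_position d m v \<le> d" using m by (simp add: P_position_def)
  have w: "w < N \<and> P_dist d m u w = 1 \<and> P_dist d m u v = P_dist d m w v + 1"
    unfolding P_dist_eq_1_iff[OF m]
    using m N uN vN uv pos unfolding w_def P_dist_def absdiff_def P_position_def
    by (auto split: if_splits)
  moreover have "z = w" if "P_dist d m u z = 1" "P_dist d m u v = P_dist d m z v + 1" for z
    using that(2) that(1)[unfolded P_dist_eq_1_iff[OF m]] m uv
    unfolding w_def P_dist_def absdiff_def P_position_def
    by (auto split: if_splits)
  ultimately show "\<exists>!w. w \<in> {0..<N} \<and> P_dist d m u w = 1 \<and> P_dist d m u v = P_dist d m w v + 1"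
    by (intro ex1I[of _ w]) auto
next
  fix u v w :: nat
  assume "P_dist d m u w = 1"
  then show "P_dist d m w v = P_dist d m u v + 1 \<or> P_dist d m u v = P_dist d m w v + 1"
    unfolding P_dist_eq_1_iff[OF m] using m
    unfolding P_dist_def absdiff_def P_position_def
    by (auto split: if_splits)
qed simp

lemma pverts_P_tree: "pverts (P_tree N d i) = {0..<N}"
  by (simp add: P_tree_def Let_def)

lemma parcs_P_tree:
  assumes m: "m \<le> d" and N: "d < N"
  shows "parcs (P_tree N d m) = {(u, v). u \<in> {0..<N} \<and> v \<in> {0..<N} \<and> P_dist d m u v = 1}"
  unfolding P_dist_eq_1_iff[OF m] using m N by (auto simp: P_tree_def Let_def)

lemma P_tree_broom:
  assumes d: "2 \<le> d" and N: "d < N"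
  shows "tree_metric.broom {0..<N} (P_dist d (d div 2)) id d"
proof -
  interpret tree_metric "{0..<N}" "P_dist d (d div 2)"
    by (rule tree_metric_P_dist) (use N in auto)
  have br: "branch id d = {d<..<N}" using N by (auto simp: branch_def)
  show ?thesis
    unfolding broom_def br geodesic_def using N
    by (auto simp: P_dist_def P_position_def absdiff_def)
qed

text \<open>
  No distance exceeds \<open>d\<close>: a leaf is at distance at most $1 + \max(m, d - m) \le d$ from any node of
  the path for $m = \lfloor d/2 \rfloor \ge 1$, and two leaves are at distance $2 \le d$.
\<close>

lemma P_tree_in_trees:
  assumes d: "2 \<le> d" and N: "d < N"
  shows "P_tree N d (d div 2) \<in> trees N d"
proof -
  let ?m = "d div 2" and ?P = "P_tree N d (d div 2)"
  have m: "?m \<le> d" by simp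
  have tm: "tree_metric (pverts ?P) (P_dist d ?m)"
    unfolding pverts_P_tree by (rule tree_metric_P_dist[OF m N])
  note tree = undirected_tree_if_tree_metric[OF _ tm parcs_P_tree[OF m N, folded pverts_P_tree[of N d ?m]]]
  have ne: "pverts ?P \<noteq> {}" using N by (simp add: pverts_P_tree)
  have dist: "tree_dist ?P u v = P_dist d ?m u v" if "u < N" "v < N" for u v
    using tree(2)[OF ne] that by (simp add: pverts_P_tree)
  have "tree_diameter ?P = d"
    unfolding tree_diameter_def
  proof (rule Max_eqI)
    show "finite {tree_dist ?P u v |u v. u \<in> pverts ?P \<and> v \<in> pverts ?P}"
      by (rule finite_image_set2) (simp_all add: pverts_P_tree)
  next
    fix y assume "y \<in> {tree_dist ?P u v |u v. u \<in> pverts ?P \<and> v \<in> pverts ?P}"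
    then obtain u v where "y = P_dist d ?m u v" "u < N" "v < N" using dist by (auto simp: pverts_P_tree)
    then show "y \<le> d" using d by (auto simp: P_dist_def P_position_def absdiff_def)
  next
    have "P_dist d ?m 0 d = d" using d by (auto simp: P_dist_def P_position_def absdiff_def)
    then show "d \<in> {tree_dist ?P u v |u v. u \<in> pverts ?P \<and> v \<in> pverts ?P}"
      using dist[of 0 d] N unfolding pverts_P_tree mem_Collect_eq
      by (intro exI[of _ 0] exI[of _ d]) simp
  qed
  then show ?thesis using tree(1)[OF ne] by (simp add: trees_def pverts_P_tree)
qed


section \<open>Uniqueness and the main result\<close>

text \<open>
  Map the path to the path and the leaves to the leaves by any bijection.
\<close>

lemma brooms_isometric:
  assumes "tree_metric V \<delta>" "tree_metric V' \<delta>'"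
    and broom: "tree_metric.broom V \<delta> f d" "tree_metric.broom V' \<delta>' f' d"
    and card: "card V = card V'"
  shows "\<exists>\<phi>. bij_betw \<phi> V V' \<and> (\<forall>u\<in>V. \<forall>v\<in>V. \<delta>' (\<phi> u) (\<phi> v) = \<delta> u v)"
proof -
  interpret A: tree_metric V \<delta> by fact
  interpret B: tree_metric V' \<delta>' by fact
  let ?R = "A.branch f d" and ?R' = "B.branch f' d"
  have f: "A.geodesic f d" and f': "B.geodesic f' d"
    using broom by (simp_all add: A.broom_def B.broom_def)
  have fV: "f i \<in> V" "f' i \<in> V'" if "i \<le> d" for i
    using f f' that by (simp_all add: A.geodesic_def B.geodesic_def)
  have "card ?R = card ?R'" using A.card_branch[OF f] B.card_branch[OF f'] card by simp
  then obtain b where b: "bij_betw b ?R ?R'"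
    using finite_same_card_bij[OF A.finite_branch B.finite_branch] by blast
  then have bR: "b x \<in> ?R'" if "x \<in> ?R" for x using that by (auto simp: bij_betw_def)
  have binj: "b x = b y \<longleftrightarrow> x = y" if "x \<in> ?R" "y \<in> ?R" for x y
    using b that by (auto simp: bij_betw_def inj_on_def)
  define \<phi> where "\<phi> u = (if u \<in> ?R then b u else f' (inv_into {..d} f u))" for u
  have \<phi>R: "\<phi> x = b x" if "x \<in> ?R" for x using that by (simp add: \<phi>_def)
  have \<phi>f: "\<phi> (f i) = f' i" if "i \<le> d" for i
    using that inv_into_f_f[OF A.geodesic_inj_on[OF f], of i] by (auto simp: \<phi>_def A.branch_def)
  have cases: "u \<in> ?R \<or> (\<exists>i\<le>d. u = f i)" if "u \<in> V" for u
    using that by (auto simp: A.branch_def)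
  have RV: "x \<in> V" if "x \<in> ?R" for x using that by (simp add: A.branch_def)
  have RV': "x \<in> V'" if "x \<in> ?R'" for x using that by (simp add: B.branch_def)
  have \<phi>V: "\<phi> u \<in> V'" if "u \<in> V" for u
    using cases[OF that] \<phi>R \<phi>f fV bR RV' by auto
  have leaf: "\<delta>' (\<phi> x) (\<phi> (f i)) = \<delta> x (f i)" if "x \<in> ?R" "i \<le> d" for x i
    using that broom bR by (simp add: \<phi>R \<phi>f A.broom_def B.broom_def)
  have iso: "\<delta>' (\<phi> u) (\<phi> v) = \<delta> u v" if u: "u \<in> V" and v: "v \<in> V" for u v
  proof -
    consider (RR) "u \<in> ?R" "v \<in> ?R" | (Rf) i where "u \<in> ?R" "i \<le> d" "v = f i"
      | (fR) i where "v \<in> ?R" "i \<le> d" "u = f i" | (ff) i j where "i \<le> d" "j \<le> d" "u = f i" "v = f j"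
      using cases[OF u] cases[OF v] by blast
    then show ?thesis
    proof cases
      case RR
      then have "\<delta>' (b u) (b v) = \<delta> u v" if "u \<noteq> v"
        using that broom bR binj by (simp add: A.broom_def B.broom_def)
      then show ?thesis
        using RR A.zero_iff[OF u u] B.zero_iff[OF \<phi>V[OF u] \<phi>V[OF u]] by (cases "u = v") (auto simp: \<phi>R)
    next
      case Rf
      then show ?thesis using leaf by simp
    next
      case fR
      then show ?thesis using leaf A.sym[OF u v] B.sym[OF \<phi>V[OF u] \<phi>V[OF v]] by simp
    next
      case ff
      then show ?thesis using f f' by (simp add: \<phi>f A.geodesic_def B.geodesic_def)
    qed
  qed
  have inj: "inj_on \<phi> V"
    using iso A.zero_iff B.zero_iff \<phi>V by (intro inj_onI) metis
  have "\<phi> ` V = V'"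
    by (rule card_subset_eq) (use \<phi>V card card_image[OF inj] B.finite_V in auto)
  then show ?thesis using inj iso by (auto simp: bij_betw_def)
qed

text \<open>
  Arcs are the pairs at distance 1, so a bijection that preserves distances preserves arcs.
\<close>

lemma digraph_iso_if_isometric:
  assumes wf: "pair_wf_digraph G"
    and G: "parcs G = {(u, v). u \<in> pverts G \<and> v \<in> pverts G \<and> \<delta> u v = 1}"
    and H: "parcs H = {(u, v). u \<in> pverts H \<and> v \<in> pverts H \<and> \<delta>' u v = 1}"
    and \<phi>: "bij_betw \<phi> (pverts G) (pverts H)"
    and iso: "\<And>u v. u \<in> pverts G \<Longrightarrow> v \<in> pverts G \<Longrightarrow> \<delta>' (\<phi> u) (\<phi> v) = \<delta> u v"
  shows "digraph_iso (with_proj G) (with_proj H)"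
proof -
  define h where "h = \<lparr>iso_verts = \<phi>, iso_arcs = map_prod \<phi> \<phi>, iso_head = snd, iso_tail = fst\<rparr>"
  have inj: "inj_on \<phi> (pverts G)" and im: "\<phi> ` pverts G = pverts H"
    using \<phi> by (auto simp: bij_betw_def)
  have "inj_on (map_prod \<phi> \<phi>) (parcs G)"
    by (rule inj_on_subset[OF map_prod_inj_on[OF inj inj]]) (auto simp: G)
  then have "pre_digraph.digraph_isomorphism (with_proj G) h"
    using inj wf by (simp add: pre_digraph.digraph_isomorphism_def h_def wf_digraph_wp_iff)
  moreover have "map_prod \<phi> \<phi> ` parcs G = parcs H"
  proof (intro equalityI subsetI)
    fix e assume "e \<in> map_prod \<phi> \<phi> ` parcs G"
    then show "e \<in> parcs H" using im iso by (auto simp: G H)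
  next
    fix e assume "e \<in> parcs H"
    then obtain u v where "e = (\<phi> u, \<phi> v)" "u \<in> pverts G" "v \<in> pverts G" "\<delta>' (\<phi> u) (\<phi> v) = 1"
      unfolding H im[symmetric] by auto
    then show "e \<in> map_prod \<phi> \<phi> ` parcs G" using iso by (auto simp: G intro!: image_eqI[of _ _ "(u, v)"])
  qed
  then have "with_proj H = app_iso h (with_proj G)"
    using im by (simp add: with_proj_def app_iso_def h_def)
  ultimately show ?thesis unfolding digraph_iso_def by blast
qed

theorem theorem4:
  fixes N d :: nat
  assumes "4 \<le> N" and "2 \<le> d" and "d \<le> N - 2"
  shows "P_tree N d (d div 2) \<in> trees N d \<and>
    (\<forall>T :: 'a pair_pre_digraph. T \<in> trees N d \<longrightarrow>
       h2_norm (P_tree N d (d div 2)) \<le> h2_norm T \<and>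
       (h2_norm T = h2_norm (P_tree N d (d div 2)) \<longrightarrow>
          digraph_iso (with_proj T) (with_proj (P_tree N d (d div 2)))))"
proof (intro conjI allI impI)
  let ?P = "P_tree N d (d div 2)" and ?m = "d div 2"
  have N: "d < N" using assms by linarith
  have m: "?m \<le> d" by simp
  show P: "?P \<in> trees N d" by (rule P_tree_in_trees[OF assms(2) N])
  have ne: "pverts ?P \<noteq> {}" using N by (simp add: pverts_P_tree)
  have tmP: "tree_metric (pverts ?P) (P_dist d ?m)"
    unfolding pverts_P_tree by (rule tree_metric_P_dist[OF m N])
  interpret P: tree_metric "pverts ?P" "P_dist d ?m" by (rule tmP)
  note arcsP = parcs_P_tree[OF m N, folded pverts_P_tree[of N d ?m]]
  have broomP: "P.broom id d" using P_tree_broom[OF assms(2) N] by (simp add: pverts_P_tree)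
  have h2P: "h2_norm ?P = sqrt (real (minimal_total d (N - (d + 1))) / (4 * real N))"
    using h2_norm_eq_total_distance[OF tmP ne arcsP] P.total_distance_broom[OF broomP]
    by (simp add: pverts_P_tree)

  fix T :: "'a pair_pre_digraph"
  assume T: "T \<in> trees N d"
  then have tree: "undirected_tree T" and card: "card (pverts T) = N" and diam: "tree_diameter T = d"
    by (simp_all add: trees_def)
  note tmT = tree_metric_tree_dist(1)[OF tree] and arcsT = tree_metric_tree_dist(2)[OF tree]
    and neT = tree_metric_tree_dist(3)[OF tree]
  interpret T: tree_metric "pverts T" "tree_dist T" by (rule tmT)
  have h2T: "h2_norm T = sqrt (real T.total_distance / (4 * real N))"
    using h2_norm_eq_total_distance[OF tmT neT arcsT] card by simp
  obtain u v where uv: "u \<in> pverts T" "v \<in> pverts T" "tree_dist T u v = d"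
  proof -
    let ?D = "{tree_dist T u v |u v. u \<in> pverts T \<and> v \<in> pverts T}"
    have "finite ?D" by (rule finite_image_set2) (simp_all add: T.finite_V)
    moreover have "?D \<noteq> {}" using neT by blast
    ultimately have "d \<in> ?D" using Max_in[of ?D] diam unfolding tree_diameter_def by auto
    then show thesis using that by blast
  qed
  obtain f where f: "T.geodesic f d" using T.ex_geodesic[OF uv(1,2)] uv(3) by auto
  note bound = T.total_distance_ge[OF f assms(2), unfolded card]
  show "h2_norm ?P \<le> h2_norm T"
    unfolding h2P h2T using bound(1) by (intro real_sqrt_le_mono divide_right_mono) simp_all
  assume "h2_norm T = h2_norm ?P"
  then have "T.total_distance = minimal_total d (N - (d + 1))"
    unfolding h2P h2T using assms(1) by simp
  then obtain g where broomT: "T.broom g d" using bound(2) by blast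
  have "card (pverts T) = card (pverts ?P)" by (simp add: card pverts_P_tree)
  from brooms_isometric[OF tmT tmP broomT broomP this]
  obtain \<phi> where "bij_betw \<phi> (pverts T) (pverts ?P)"
    "\<And>u v. u \<in> pverts T \<Longrightarrow> v \<in> pverts T \<Longrightarrow> P_dist d ?m (\<phi> u) (\<phi> v) = tree_dist T u v" by blast
  moreover have "pair_graph T" using tree by (simp add: undirected_tree_def)
  then have "pair_wf_digraph T" by (rule pair_graph.axioms(1)[THEN pair_digraph.axioms(1), THEN pair_fin_digraph.axioms(1)])
  ultimately show "digraph_iso (with_proj T) (with_proj ?P)"
    using digraph_iso_if_isometric[OF _ arcsT arcsP] by blast
qed

end
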